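(* Let $X$ be a planar polynomial vector field whose Newton polytope $\mathcal{P}_X$ is favorable, and let $(\alpha,\beta)$ be the weight vector determined by the line $\{\alpha m+\beta n=\delta\}$ containing the upper main segment $\gamma_h$ of $\mathcal{P}_X$. After a Poincaré--Lyapunov compactification in the positive $y$-direction with weight $(\alpha,\beta)$, the following hold: (a) The lower boundary of the Newton polytope $\mathcal{P}_{\overline{X}^{+}_{y}}$ is precisely the image of the left upper part of $\mathcal{P}^{U}_{X}$. (b) If the upper main vertex $p_h\in\mathcal{P}_X$ is contained in $\{-1\}\times\mathbb{N}$ or $\{0\}\times\mathbb{N}$, then the origin is an elementary point for $\overline{X}^{+}_{y}$.
   Context: **Newton polytope.** Every planar polynomial vector field is written uniquely as a finite sum $X(x,y)=\sum_{m,n} x^{m}y^{n}\big(a_{m,n}x\frac{\partial}{\partial x}+b_{m,n}y\frac{\partial}{\partial y}\big)$ with $m,n\in\mathbb{Z}$, $a_{m,n},b_{m,n}\in\mathbb{R}$, where $a_{m,n}=0$ if $m<-1$ or $n\le -1$, and $b_{m,n}=0$ if $m\le -1$ or $n<-1$. The support is $\mathcal{S}_X=\{(m,n)\in\mathbb{Z}^2: a_{m,n}^2+b_{m,n}^2\neq 0\}$ and the Newton polytope $\mathcal{P}_X$ is the convex hull of $\mathcal{S}_X$ (same definition for a vector field in variables $(u,v)$, using the exponents of $u$ and $v$ in this order). Let $\mathcal{P}_+$ be the convex hull of $\mathcal{S}_X+(\mathbb{R}_{\ge 0})^2$. If $\mathcal{P}_X$ has non-empty interior, the lower boundary $\mathcal{P}^L_X$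 is the union of the compact segments of $\partial\mathcal{P}_+$ and the upper boundary $\mathcal{P}^U_X$ is the closure of $\partial\mathcal{P}_X\setminus\partial\mathcal{P}_+$; if the interior is empty, $\mathcal{P}_X=\mathcal{P}^L_X=\mathcal{P}^U_X$. $\mathcal{P}_X$ is favorable if $\mathcal{P}^U_X$ has at least one segment with negative slope. **Vertices and segments.** The vertices of $\mathcal{P}_X$ are enumerated counterclockwise $p_0,\dots,p_k$, with $p_0$ the first point of the support in lexicographical order; $\gamma_l$ is the edge joining $p_{l-1}$ to $p_l$ and $\gamma_{k+1}$ the edge joining $p_k$ to $p_0$. The upper main vertex $p_h=(m_h,n_h)$ is the last point of $\mathcal{S}_X$ in lexicographical order such that $n_h\ge n$ for all $(m,n)\in\mathcal{P}_X$; the upper main segment $\gamma_h$ is the edge that ends at $p_h$ in the counterclockwise enumeration. When $\mathcal{P}_X$ is favorable, $\gamma_h$ lies in a line $\{\alpha m+\beta n=\delta\}$ with $\alpha,\beta$ positive integers, and $\delta$ is the maximum of $\alpha m+\beta n$ on $\mathcal{S}_X$. Enumerating the segments of $\mathcal{P}^U_X$ counterclockwise as $\gamma_1^U,\dots,\gamma_{l-1}^U,\gamma_h,\gamma_{l+1}^U,\dots,\gamma_k^U$, the right upper part of $\mathcal{P}^U_X$ is the union of $\gamma_1^U,\dots,\gamma_{l-1}^U$ and the left upper part is the union of $\gamma_{l+1}^U,\dots,\gamma_k^U$. **Compactification in the positive $y$-direction.** With weight $(\alpha,\beta)$, it is the vector field obtained by the change of variables $x=uv^{-\alpha}$, $y=v^{-\beta}$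 followed by multiplication by $v^{\delta}$: $$\overline{X}^{+}_{y}(u,v)=\sum_{(m,n)\in\mathcal{S}_X}v^{\delta-(\alpha m+\beta n)}u^{m}\Big(\big(a_{m,n}-\tfrac{\alpha}{\beta}b_{m,n}\big)u\frac{\partial}{\partial u}-\frac{1}{\beta}b_{m,n}v\frac{\partial}{\partial v}\Big).$$ The "image" in (a) is under the induced map of exponents $(m,n)\mapsto(m,\delta-\alpha m-\beta n)$. **Elementary point.** A point $q$ is an elementary point of a vector field if it is a regular point, or a hyperbolic or semi-hyperbolic singularity; a singularity is semi-hyperbolic if the Jacobian matrix there has exactly one nonzero eigenvalue.
   Formalization: Part (a) is stated only when the Newton polytope of X has non-empty interior; if it is a single segment of negative slope, the left upper part is empty while the lower boundary of the compactified polytope is a segment, so (a) fails. *)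

theory Defs
  imports "HOL-Analysis.Analysis" "HOL-Computational_Algebra.Polynomial"
begin

section \<open>Planar polynomial vector fields\<close>

text \<open>
  A field \<open>P \<partial>/\<partial>x + Q \<partial>/\<partial>y\<close> is the pair \<open>(P, Q)\<close>, with \<open>P, Q\<close> in \<open>(\<real>[x])[y]\<close>: the coefficient
  of \<open>x^i y^j\<close> in \<open>P\<close> is \<open>coeff (coeff P j) i\<close>.
\<close>

type_synonym poly_vf = "real poly poly \<times> real poly poly"

definition vf :: "poly_vf \<Rightarrow> real^2 \<Rightarrow> real^2" where
  "vf X z = vector [poly (poly (fst X) [:z $ 2:]) (z $ 1), poly (poly (snd X) [:z $ 2:]) (z $ 1)]"

text \<open>
  The numbers \<open>a\<^sub>m\<^sub>,\<^sub>n\<close> and \<open>b\<^sub>m\<^sub>,\<^sub>n\<close> in \<open>X = \<Sum> x^m y^n (a\<^sub>m\<^sub>,\<^sub>n x \<partial>/\<partial>x + b\<^sub>m\<^sub>,\<^sub>n y \<partial>/\<partial>y)\<close>: they are the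
  coefficient of \<open>x^(m+1) y^n\<close> in \<open>P\<close> and that of \<open>x^m y^(n+1)\<close> in \<open>Q\<close>.
\<close>

definition a_coeff :: "poly_vf \<Rightarrow> int \<Rightarrow> int \<Rightarrow> real" where
  "a_coeff X m n = (if m < -1 \<or> n \<le> -1 then 0 else coeff (coeff (fst X) (nat n)) (nat (m + 1)))"

definition b_coeff :: "poly_vf \<Rightarrow> int \<Rightarrow> int \<Rightarrow> real" where
  "b_coeff X m n = (if m \<le> -1 \<or> n < -1 then 0 else coeff (coeff (snd X) (nat (n + 1))) (nat m))"


section \<open>The Newton polytope and its boundaries\<close>

definition vf_support :: "poly_vf \<Rightarrow> (int \<times> int) set" where
  "vf_support X = {(m, n). (a_coeff X m n)\<^sup>2 + (b_coeff X m n)\<^sup>2 \<noteq> 0}"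

definition emb :: "int \<times> int \<Rightarrow> real \<times> real" where
  "emb p = (real_of_int (fst p), real_of_int (snd p))"

definition newton_polytope :: "poly_vf \<Rightarrow> (real \<times> real) set" where
  "newton_polytope X = convex hull (emb ` vf_support X)"

definition newton_polytope_plus :: "poly_vf \<Rightarrow> (real \<times> real) set" where
  "newton_polytope_plus X =
     convex hull {s + t |s t. s \<in> emb ` vf_support X \<and> 0 \<le> fst t \<and> 0 \<le> snd t}"

text \<open>
  The segments of the boundary of a planar polygon are its one-dimensional faces.
\<close>

definition lower_boundary :: "poly_vf \<Rightarrow> (real \<times> real) set" where
  "lower_boundary X =
     (if interior (newton_polytope X) = {} then newton_polytope X
      else \<Union>{F. F edge_of newton_polytope_plus X \<and> compact F})"

definition upper_boundary :: "poly_vf \<Rightarrow> (real \<times> real) set" where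
  "upper_boundary X =
     (if interior (newton_polytope X) = {} then newton_polytope X
      else closure (frontier (newton_polytope X) - frontier (newton_polytope_plus X)))"

definition negative_slope :: "(real \<times> real) set \<Rightarrow> bool" where
  "negative_slope F \<longleftrightarrow> (\<exists>p q. F = closed_segment p q \<and> fst p < fst q \<and> snd q < snd p)"

definition favorable :: "poly_vf \<Rightarrow> bool" where
  "favorable X \<longleftrightarrow>
     (\<exists>F. F edge_of newton_polytope X \<and> F \<subseteq> upper_boundary X \<and> negative_slope F)"


section \<open>Vertices and segments\<close>

definition lex_le :: "int \<times> int \<Rightarrow> int \<times> int \<Rightarrow> bool" where
  "lex_le p q \<longleftrightarrow> fst p < fst q \<or> (fst p = fst q \<and> snd p \<le> snd q)"

definition first_support_point :: "poly_vf \<Rightarrow> int \<times> int" where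
  "first_support_point X = (THE p. p \<in> vf_support X \<and> (\<forall>q\<in>vf_support X. lex_le p q))"

text \<open>Positive iff \<open>r\<close> lies strictly to the left of the directed line from \<open>p\<close> to \<open>q\<close>.\<close>

definition orient :: "real \<times> real \<Rightarrow> real \<times> real \<Rightarrow> real \<times> real \<Rightarrow> real" where
  "orient p q r = (fst q - fst p) * (snd r - snd p) - (snd q - snd p) * (fst r - fst p)"

text \<open>
  The list \<open>[p\<^sub>0, \<dots>, p\<^sub>k]\<close> of all vertices in counterclockwise order: the polytope lies to the left
  of every directed line from a vertex to its cyclic successor. This determines the list. If the
  polytope is a segment, the list consists of its two end points.
\<close>

definition ccw_vertices :: "poly_vf \<Rightarrow> (real \<times> real) list \<Rightarrow> bool" where
  "ccw_vertices X ps \<longleftrightarrow>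
     ps \<noteq> [] \<and> distinct ps \<and> set ps = {v. v extreme_point_of newton_polytope X} \<and>
     ps ! 0 = emb (first_support_point X) \<and>
     (\<forall>i<length ps. \<forall>q\<in>newton_polytope X. 0 \<le> orient (ps ! i) (ps ! (Suc i mod length ps)) q)"

text \<open>
  The segment \<open>\<gamma>\<^sub>l\<close> from \<open>p\<^sub>l\<^sub>-\<^sub>1\<close> to \<open>p\<^sub>l\<close>, for \<open>1 \<le> l \<le> k + 1 = length ps\<close>, where \<open>\<gamma>\<^sub>k\<^sub>+\<^sub>1\<close> returns to \<open>p\<^sub>0\<close>.
\<close>

definition seg :: "(real \<times> real) list \<Rightarrow> nat \<Rightarrow> (real \<times> real) set" where
  "seg ps l = closed_segment (ps ! (l - 1)) (ps ! (l mod length ps))"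

definition upper_main_vertex :: "poly_vf \<Rightarrow> int \<times> int" where
  "upper_main_vertex X =
     (let C = {p \<in> vf_support X. \<forall>q\<in>newton_polytope X. snd q \<le> real_of_int (snd p)}
      in THE p. p \<in> C \<and> (\<forall>q\<in>C. lex_le q p))"

text \<open>The \<open>l\<close> such that \<open>\<gamma>\<^sub>l\<close> ends at the upper main vertex.\<close>

definition upper_main_index :: "poly_vf \<Rightarrow> (real \<times> real) list \<Rightarrow> nat" where
  "upper_main_index X ps =
     (THE l. l \<in> {1..length ps} \<and> ps ! (l mod length ps) = emb (upper_main_vertex X))"

definition upper_main_segment :: "poly_vf \<Rightarrow> (real \<times> real) list \<Rightarrow> (real \<times> real) set" where
  "upper_main_segment X ps = seg ps (upper_main_index X ps)"

text \<open>
  The enumeration of all segments starts at \<open>p\<^sub>0\<close>, which is the lower end of the leftmost column of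
  the polytope, so it meets the segments of the upper boundary in one consecutive run, and cutting
  it at \<open>p\<^sub>0\<close> does not break that run.
\<close>

definition left_upper_part :: "poly_vf \<Rightarrow> (real \<times> real) list \<Rightarrow> (real \<times> real) set" where
  "left_upper_part X ps =
     \<Union>{seg ps l |l. upper_main_index X ps < l \<and> l \<le> length ps \<and> seg ps l \<subseteq> upper_boundary X}"


section \<open>Compactification in the positive y-direction\<close>

text \<open>
  The monomial \<open>u^i v^j\<close> is \<open>monom (monom 1 i) j\<close>. The arguments of \<open>nat\<close> are nonnegative wherever
  the coefficient in front is nonzero, as soon as \<open>\<delta>\<close> is an upper bound of \<open>\<alpha>m + \<beta>n\<close> on the support.
\<close>

definition y_compactification :: "int \<Rightarrow> int \<Rightarrow> int \<Rightarrow> poly_vf \<Rightarrow> poly_vf" where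
  "y_compactification \<alpha> \<beta> \<delta> X =
     (\<Sum>(m, n)\<in>vf_support X.
        monom (monom (a_coeff X m n - real_of_int \<alpha> / real_of_int \<beta> * b_coeff X m n) (nat (m + 1)))
          (nat (\<delta> - (\<alpha> * m + \<beta> * n))),
      \<Sum>(m, n)\<in>vf_support X.
        monom (monom (- (1 / real_of_int \<beta>) * b_coeff X m n) (nat m))
          (nat (\<delta> - (\<alpha> * m + \<beta> * n) + 1)))"

definition exponent_map :: "int \<Rightarrow> int \<Rightarrow> int \<Rightarrow> real \<times> real \<Rightarrow> real \<times> real" where
  "exponent_map \<alpha> \<beta> \<delta> p =
     (fst p, real_of_int \<delta> - real_of_int \<alpha> * fst p - real_of_int \<beta> * snd p)"


section \<open>Elementary points\<close>

definition complex_eigenvalue :: "real^'n^'n \<Rightarrow> complex \<Rightarrow> bool" where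
  "complex_eigenvalue A l \<longleftrightarrow> (\<exists>w. w \<noteq> 0 \<and> map_matrix complex_of_real A *v w = l *s w)"

definition hyperbolic_singularity :: "(real^2 \<Rightarrow> real^2) \<Rightarrow> real^2 \<Rightarrow> bool" where
  "hyperbolic_singularity f q \<longleftrightarrow>
     f q = 0 \<and> (\<forall>l. complex_eigenvalue (jacobian f (at q)) l \<longrightarrow> Re l \<noteq> 0)"

text \<open>
  The two eigenvalues are counted with multiplicity, so exactly one is nonzero iff zero is an
  eigenvalue and there is a unique nonzero one.
\<close>

definition semi_hyperbolic_singularity :: "(real^2 \<Rightarrow> real^2) \<Rightarrow> real^2 \<Rightarrow> bool" where
  "semi_hyperbolic_singularity f q \<longleftrightarrow>
     f q = 0 \<and> complex_eigenvalue (jacobian f (at q)) 0 \<and>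
     (\<exists>!l. complex_eigenvalue (jacobian f (at q)) l \<and> l \<noteq> 0)"

definition elementary_point :: "(real^2 \<Rightarrow> real^2) \<Rightarrow> real^2 \<Rightarrow> bool" where
  "elementary_point f q \<longleftrightarrow>
     f q \<noteq> 0 \<or> hyperbolic_singularity f q \<or> semi_hyperbolic_singularity f q"

end

theory Submission
  imports Defs "HOL-Library.Set_Algebras"
begin

text \<open>
  The weight \<open>\<alpha>m + \<beta>n\<close> is at most \<open>\<delta>\<close> on the polytope, so compactifying moves the support by the affine
  exponent map \<open>\<phi>\<close>. The compact edges of the lower boundary of \<open>\<phi>(P)\<close> minimize a linear form with
  positive coefficients. Pulled back by \<open>\<phi>\<close>, they are the edges of \<open>P\<close> with an outer normal \<open>(p, q)\<close> such
  that \<open>q > 0\<close> and \<open>p\<beta> < q\<alpha>\<close>: those met when walking counterclockwise from the upper main vertex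
  until the leftmost column. All steps of that walk go left, except for a possible final step down
  the leftmost column, which is not part of the upper boundary.

  If the upper main vertex has abscissa \<open>-1\<close>, the field does not vanish at the origin. If it has
  abscissa \<open>0\<close>, it determines the diagonal of the Jacobian there, which is upper triangular.
\<close>

section \<open>Faces of planar convex hulls\<close>

text \<open>Let \<open>(c, d)\<close> be a linear form on the image. Composed with the exponent map
  it is, up to a constant, minus the form with coefficients \<open>d * \<alpha> - c\<close> and
  \<open>d * \<beta>\<close>. As \<open>\<beta> > 0\<close>, the conditions \<open>c > 0\<close> and
  \<open>d > 0\<close> thus become \<open>p * \<beta> < q * \<alpha>\<close> and
  \<open>q > 0\<close> for the outer normal \<open>(p, q)\<close>. These normals fill the open angle
  from \<open>(\<alpha>, \<beta>)\<close> counterclockwise to \<open>(-1, 0)\<close>: one end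
  excludes the main segment, the other the leftmost column.

  The vertex list supplies only weak half-plane inequalities, no angles or slopes. The order of the
  edges is therefore recovered from the signs of horizontal steps and of cross products of
  consecutive steps; strictness has to come from the nonempty interior or from the extremality of
  vertices.\<close>

definition argmin_face :: "'a::real_inner \<Rightarrow> 'a set \<Rightarrow> 'a set" where
  "argmin_face a P = {z \<in> P. \<forall>w\<in>P. a \<bullet> z \<le> a \<bullet> w}"

lemma minimizer_not_in_interior:
  fixes a :: "'a::euclidean_space"
  assumes "a \<noteq> 0" "\<And>y. y \<in> S \<Longrightarrow> a \<bullet> w \<le> a \<bullet> y"
  shows "w \<notin> interior S"
proof -
  have "interior S \<subseteq> interior {y. a \<bullet> y \<ge> a \<bullet> w}"
    using assms by (intro interior_mono) auto
  then show ?thesis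
    using assms(1) by auto
qed

lemma not_constant_on_nonempty_interior:
  fixes a :: "'a::euclidean_space"
  assumes "a \<noteq> 0" "interior S \<noteq> {}"
  shows "\<exists>z\<in>S. a \<bullet> z \<noteq> c"
proof (rule ccontr)
  assume "\<not> ?thesis"
  then have "S \<subseteq> {z. a \<bullet> z = c}" by auto
  then have "interior S \<subseteq> interior {z. a \<bullet> z = c}" by (rule interior_mono)
  then show False using assms by simp
qed

text \<open>This is \<open>newton_polytope_plus\<close> for a bare set of points, so that the same
  facts serve both the field and its compactification.\<close>

definition quadrant_hull :: "(real \<times> real) set \<Rightarrow> (real \<times> real) set" where
  "quadrant_hull S = convex hull {s + t |s t. s \<in> S \<and> 0 \<le> fst t \<and> 0 \<le> snd t}"

text \<open>Convex hulls commute with Minkowski sums, and the quadrant is its own hull.\<close>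

lemma quadrant_hull_eq:
  "quadrant_hull S = {p + t |p t. p \<in> convex hull S \<and> 0 \<le> fst t \<and> 0 \<le> snd t}"
proof -
  let ?C = "{t::real\<times>real. 0 \<le> fst t \<and> 0 \<le> snd t}"
  have "convex ?C"
    by (auto simp: convex_def)
  then have "convex hull (S + ?C) = (convex hull S) + ?C"
    by (simp add: convex_hull_set_plus hull_same)
  moreover have "{s + t |s t. s \<in> S \<and> 0 \<le> fst t \<and> 0 \<le> snd t} = S + ?C"
    unfolding set_plus_def by blast
  moreover have "{p + t |p t. p \<in> convex hull S \<and> 0 \<le> fst t \<and> 0 \<le> snd t} = (convex hull S) + ?C"
    unfolding set_plus_def by blast
  ultimately show ?thesis
    unfolding quadrant_hull_def by simp
qed

lemma convex_quadrant_hull: "convex (quadrant_hull S)"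
  unfolding quadrant_hull_def by (rule convex_convex_hull)

lemma hull_subset_quadrant_hull: "convex hull S \<subseteq> quadrant_hull S"
  unfolding quadrant_hull_eq by (force intro: exI[of _ "0::real\<times>real"])

lemma quadrant_hull_add:
  assumes "z \<in> quadrant_hull S" "0 \<le> fst t" "0 \<le> snd t"
  shows "z + t \<in> quadrant_hull S"
proof -
  obtain p u where "z = p + u" "p \<in> convex hull S" "0 \<le> fst u" "0 \<le> snd u"
    using assms(1) unfolding quadrant_hull_eq by blast
  moreover have "z + t = p + (u + t)" "0 \<le> fst (u + t)" "0 \<le> snd (u + t)"
    using calculation assms by (auto simp: add.assoc)
  ultimately show ?thesis
    unfolding quadrant_hull_eq by blast
qed

text \<open>Unit steps along the axes stay inside the set, so they cannot lower the form below its
  minimum.\<close>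

lemma quadrant_hull_supporting_nonneg:
  assumes "w \<in> quadrant_hull S" "\<And>z. z \<in> quadrant_hull S \<Longrightarrow> a \<bullet> w \<le> a \<bullet> z"
  shows "0 \<le> fst a" "0 \<le> snd a"
  using assms(2)[OF quadrant_hull_add[OF assms(1), of "(1,0)"]]
    assms(2)[OF quadrant_hull_add[OF assms(1), of "(0,1)"]]
  by (auto simp: inner_prod_def algebra_simps)

lemma frontier_quadrant_hullE:
  assumes "w \<in> frontier (quadrant_hull S)" "w \<in> convex hull S"
  obtains a where "a \<noteq> 0" "0 \<le> fst a" "0 \<le> snd a" "\<And>z. z \<in> convex hull S \<Longrightarrow> a \<bullet> w \<le> a \<bullet> z"
proof -
  have w: "w \<in> quadrant_hull S" "w \<notin> interior (quadrant_hull S)"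
    using assms hull_subset_quadrant_hull by (auto simp: frontier_def)
  \<comment> \<open>The supporting hyperplane theorem speaks of the relative interior, which agrees
    with the interior once the latter is nonempty; otherwise a hyperplane containing the set
    supports it everywhere.\<close>
  have "\<exists>a. a \<noteq> 0 \<and> (\<forall>z\<in>quadrant_hull S. a \<bullet> w \<le> a \<bullet> z)"
  proof (cases "interior (quadrant_hull S) = {}")
    case False
    then have "w \<notin> rel_interior (quadrant_hull S)"
      using w by (simp add: rel_interior_nonempty_interior)
    then show ?thesis
      using supporting_hyperplane_rel_boundary[OF convex_quadrant_hull w(1)] by metis
  next
    case True
    then obtain a b where "a \<noteq> 0" "quadrant_hull S \<subseteq> {x. a \<bullet> x = b}"
      using empty_interior_subset_hyperplane[OF convex_quadrant_hull] by metis
    then show ?thesis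
      using w(1) by (metis (mono_tags, lifting) mem_Collect_eq order_refl subsetD)
  qed
  then obtain a where a: "a \<noteq> 0" "\<And>z. z \<in> quadrant_hull S \<Longrightarrow> a \<bullet> w \<le> a \<bullet> z" by blast
  show thesis
    using that[OF a(1) quadrant_hull_supporting_nonneg[OF w(1) a(2)]] a(2) hull_subset_quadrant_hull
    by blast
qed

text \<open>Adding the quadrant does not lower the minimum of \<open>fst\<close>. This keeps the
  inside of the leftmost column out of the upper boundary.\<close>

lemma leftmost_in_frontier_quadrant_hull:
  assumes "w \<in> convex hull S" "\<And>z. z \<in> convex hull S \<Longrightarrow> fst w \<le> fst z"
  shows "w \<in> frontier (quadrant_hull S)"
proof -
  have "w \<notin> interior (quadrant_hull S)"
  proof (rule minimizer_not_in_interior[of "(1,0)"])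
    show "(1, 0) \<noteq> (0::real\<times>real)" by (simp add: zero_prod_def)
    show "(1, 0) \<bullet> w \<le> (1, 0) \<bullet> y" if "y \<in> quadrant_hull S" for y
      using that assms(2) unfolding quadrant_hull_eq by (force simp: inner_prod_def)
  qed
  then show ?thesis
    using assms(1) hull_subset_quadrant_hull closure_subset unfolding frontier_def by blast
qed

text \<open>Both coefficients being positive, every nonzero displacement in the quadrant strictly
  raises the form.\<close>

lemma argmin_face_quadrant_hull:
  assumes "0 < fst a" "0 < snd a" "argmin_face a (convex hull S) \<noteq> {}"
  shows "argmin_face a (quadrant_hull S) = argmin_face a (convex hull S)"
proof
  obtain y where y: "y \<in> argmin_face a (convex hull S)" using assms(3) by blast
  show "argmin_face a (quadrant_hull S) \<subseteq> argmin_face a (convex hull S)"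
  proof
    fix z assume z: "z \<in> argmin_face a (quadrant_hull S)"
    then obtain p t where pt: "z = p + t" "p \<in> convex hull S" "0 \<le> fst t" "0 \<le> snd t"
      unfolding argmin_face_def quadrant_hull_eq by blast
    have "a \<bullet> z \<le> a \<bullet> p"
      using z pt(2) hull_subset_quadrant_hull by (auto simp: argmin_face_def)
    then have le0: "fst a * fst t + snd a * snd t \<le> 0"
      by (simp add: pt(1) inner_prod_def algebra_simps)
    moreover have nn: "0 \<le> fst a * fst t" "0 \<le> snd a * snd t"
      using assms pt by auto
    ultimately have "fst a * fst t = 0" "snd a * snd t = 0" by linarith+
    then have "t = 0" using assms by (auto simp: prod_eq_iff)
    then have "z = p" using pt by simp
    then show "z \<in> argmin_face a (convex hull S)"
      using z pt(2) hull_subset_quadrant_hull by (auto simp: argmin_face_def)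
  qed
  show "argmin_face a (convex hull S) \<subseteq> argmin_face a (quadrant_hull S)"
  proof
    fix z assume z: "z \<in> argmin_face a (convex hull S)"
    have "a \<bullet> z \<le> a \<bullet> w" if w: "w \<in> quadrant_hull S" for w
    proof -
      obtain p t where pt: "w = p + t" "p \<in> convex hull S" "0 \<le> fst t" "0 \<le> snd t"
        using w unfolding quadrant_hull_eq by blast
      have "a \<bullet> z \<le> a \<bullet> p" using z pt by (auto simp: argmin_face_def)
      moreover have "0 \<le> fst a * fst t" "0 \<le> snd a * snd t"
        using assms pt by auto
      ultimately show ?thesis by (simp add: pt(1) inner_prod_def algebra_simps)
    qed
    then show "z \<in> argmin_face a (quadrant_hull S)"
      using z hull_subset_quadrant_hull by (auto simp: argmin_face_def)
  qed
qed

lemma argmin_face_edge: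
  fixes Q :: "(real \<times> real) set"
  assumes "convex Q" "a \<noteq> 0" "x \<in> argmin_face a Q" "y \<in> argmin_face a Q" "x \<noteq> y"
  shows "argmin_face a Q edge_of Q"
proof -
  have eq: "argmin_face a Q = Q \<inter> {z. a \<bullet> z = a \<bullet> x}"
    using assms(3) by (force simp: argmin_face_def)
  have "argmin_face a Q face_of Q"
    unfolding eq using assms by (intro face_of_Int_supporting_hyperplane_ge) (auto simp: argmin_face_def)
  moreover have "aff_dim (argmin_face a Q) = 1"
  proof (rule antisym)
    have "aff_dim (argmin_face a Q) \<le> aff_dim {z. a \<bullet> z = a \<bullet> x}"
      unfolding eq by (intro aff_dim_subset) auto
    then show "aff_dim (argmin_face a Q) \<le> 1"
      using assms(2) by (simp add: aff_dim_hyperplane)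
    have "aff_dim {x, y} \<le> aff_dim (argmin_face a Q)"
      using assms by (intro aff_dim_subset) auto
    then show "1 \<le> aff_dim (argmin_face a Q)"
      using assms(5) by simp
  qed
  ultimately show ?thesis
    by (simp add: edge_of_def)
qed

section \<open>Compact edges of the hull enlarged by the quadrant\<close>

lemma edge_of_two_points:
  assumes "F edge_of Q"
  obtains x y where "x \<in> F" "y \<in> F" "x \<noteq> y"
proof -
  have "aff_dim F = 1" using assms by (simp add: edge_of_def)
  then have "F \<noteq> {}" "\<nexists>a. F = {a}" by auto
  then show thesis using that by blast
qed

text \<open>A chord of a face along a recession direction would extend to a ray inside the face.\<close>

lemma compact_face_translate_False:
  fixes F :: "'a::real_inner set"
  assumes "F face_of Q" "compact F" "x \<in> F" "y \<in> F" "y - x = c *\<^sub>R d" "c > 0"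
    "\<And>k. 0 \<le> k \<Longrightarrow> y + k *\<^sub>R d \<in> Q"
  shows "d = 0"
proof (rule ccontr)
  assume d: "d \<noteq> 0"
  have "y + k *\<^sub>R d \<in> F" if k: "k > 0" for k
  proof -
    have "y = (1 - c / (c + k)) *\<^sub>R x + (c / (c + k)) *\<^sub>R (y + k *\<^sub>R d)"
    proof -
      have x: "x = y - c *\<^sub>R d" using assms(5) by (simp add: algebra_simps)
      have "(c / (c + k)) *\<^sub>R (k *\<^sub>R d) = (1 - c / (c + k)) *\<^sub>R (c *\<^sub>R d)"
        using assms(6) k by (simp add: field_simps)
      then show ?thesis unfolding x by (simp add: algebra_simps)
    qed
    moreover have "x \<noteq> y + k *\<^sub>R d"
    proof
      assume "x = y + k *\<^sub>R d"
      then have "c *\<^sub>R d + k *\<^sub>R d = 0" using assms(5)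
          by (metis add.commute add_diff_cancel_left' diff_add_cancel add_left_cancel add_0_right add.assoc)
      then have "(c + k) *\<^sub>R d = 0" by (simp add: algebra_simps)
      then show False using d assms(6) k by auto
    qed
    moreover have "0 < c / (c + k)" "c / (c + k) < 1" using assms(6) k by auto
    ultimately have "y \<in> open_segment x (y + k *\<^sub>R d)"
      by (auto simp: in_segment)
    moreover have "x \<in> Q" using assms(1,3) face_of_imp_subset by blast
    ultimately show ?thesis
      using face_ofD[OF assms(1)] assms(4,7) k by fastforce
  qed
  moreover obtain B where "\<And>z. z \<in> F \<Longrightarrow> norm z \<le> B"
    using compact_imp_bounded[OF assms(2)] by (auto simp: bounded_iff)
  moreover define k where "k = (\<bar>B\<bar> + norm y + 1) / norm d"
  ultimately have "norm (y + k *\<^sub>R d) \<le> B" and kp: "k > 0"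
    using d by (auto simp: divide_pos_pos add_nonneg_pos)
  moreover have "norm (k *\<^sub>R d) = \<bar>B\<bar> + norm y + 1"
    using d kp by (simp add: k_def)
  moreover have "norm (k *\<^sub>R d) \<le> norm (y + k *\<^sub>R d) + norm y"
    using norm_triangle_ineq[of "y + k *\<^sub>R d" "- y"] by simp
  ultimately show False by linarith
qed

text \<open>A form supporting the set at a relatively interior point of \<open>F\<close> is constant
  on \<open>F\<close> and has nonnegative coefficients. A zero coefficient would make
  \<open>F\<close> parallel to an axis, that is, to a recession direction, which compactness
  forbids.\<close>

lemma compact_edge_quadrant_hull_argmin:
  assumes int: "interior (convex hull S) \<noteq> {}"
    and F: "F edge_of quadrant_hull S" "compact F"
  obtains a where "0 < fst a" "0 < snd a" "F \<subseteq> argmin_face a (convex hull S)"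
proof -
  let ?Q = "quadrant_hull S"
  have face: "F face_of ?Q" and dim: "aff_dim F = 1" using F by (auto simp: edge_of_def)
  have intQ: "interior ?Q \<noteq> {}"
    using int interior_mono[OF hull_subset_quadrant_hull, of S] by blast
  have "F \<noteq> ?Q"
    using dim aff_dim_nonempty_interior[OF intQ] by auto
  then have disj: "F \<inter> interior ?Q = {}"
    using face face_of_disjoint_interior by blast
  have FQ: "F \<subseteq> ?Q" using face face_of_imp_subset by blast
  obtain x y where xy: "x \<in> F" "y \<in> F" "x \<noteq> y" using edge_of_two_points[OF F(1)] .
  have convF: "convex F" using face face_of_imp_convex by blast
  have "rel_interior F \<noteq> {}"
    using xy convF rel_interior_eq_empty by blast
  then obtain w where w: "w \<in> rel_interior F" by blast
  then have wF: "w \<in> F" using rel_interior_subset by blast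
  have "w \<notin> rel_interior ?Q"
    using disj wF intQ by (auto simp: rel_interior_nonempty_interior)
  then obtain a where a: "a \<noteq> 0" "\<And>z. z \<in> ?Q \<Longrightarrow> a \<bullet> w \<le> a \<bullet> z"
    using supporting_hyperplane_rel_boundary[OF convex_quadrant_hull subsetD[OF FQ wF]] by metis
  have nn: "0 \<le> fst a" "0 \<le> snd a"
    using quadrant_hull_supporting_nonneg[of w S a] a(2) wF FQ by auto
  \<comment> \<open>The segment from \<open>z\<close> to \<open>w\<close> can be prolonged beyond
    \<open>w\<close> inside \<open>F\<close>; minimality of \<open>w\<close> against the prolonged
    end gives the reverse inequality.\<close>
  have const: "a \<bullet> z = a \<bullet> w" if z: "z \<in> F" for z
  proof -
    obtain e where e: "e > 1" "(1 - e) *\<^sub>R z + e *\<^sub>R w \<in> F"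
      using w convex_rel_interior_iff[OF convF] z by blast
    then have "a \<bullet> w \<le> (1 - e) * (a \<bullet> z) + e * (a \<bullet> w)"
      using a(2)[of "(1 - e) *\<^sub>R z + e *\<^sub>R w"] FQ by (auto simp: inner_add_right)
    then have "0 \<le> (1 - e) * (a \<bullet> z - a \<bullet> w)"
      by (simp add: algebra_simps)
    then have "a \<bullet> z \<le> a \<bullet> w"
      using e(1) by (simp add: zero_le_mult_iff)
    then show ?thesis using a(2)[of z] z FQ by force
  qed
  have no_recession: "d = 0"
    if d: "0 \<le> fst d" "0 \<le> snd d" and c: "y - x = c *\<^sub>R d" for c d
  proof -
    have *: "d = 0" if "u \<in> F" "v \<in> F" "v - u = c *\<^sub>R d" "c > 0" for u v c
      using that FQ d
      by (intro compact_face_translate_False[OF face F(2), of u v c d] quadrant_hull_add) auto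
    consider "c > 0" | "c < 0" | "c = 0" by linarith
    then show ?thesis
    proof cases
      case 1 then show ?thesis using * xy c by blast
    next
      case 2
      have "x - y = (- c) *\<^sub>R d" using c by (simp add: algebra_simps)
      then show ?thesis using * xy 2 by (metis neg_0_less_iff_less)
    next
      case 3 then show ?thesis using xy c by simp
    qed
  qed
  have axy: "fst a * (fst y - fst x) + snd a * (snd y - snd x) = 0"
    using const[of x] const[of y] xy by (simp add: inner_prod_def algebra_simps)
  have "fst a \<noteq> 0"
  proof
    assume "fst a = 0"
    then have "snd a \<noteq> 0" using a(1) by (simp add: prod_eq_iff)
    then have "snd y = snd x" using axy \<open>fst a = 0\<close> by simp
    then have "y - x = (fst y - fst x) *\<^sub>R (1, 0)" by (simp add: prod_eq_iff)
    from no_recession[OF _ _ this] show False by (simp add: zero_prod_def)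
  qed
  moreover have "snd a \<noteq> 0"
  proof
    assume "snd a = 0"
    then have "fst y = fst x" using axy \<open>fst a \<noteq> 0\<close> by simp
    then have "y - x = (snd y - snd x) *\<^sub>R (0, 1)" by (simp add: prod_eq_iff)
    from no_recession[OF _ _ this] show False by (simp add: zero_prod_def)
  qed
  ultimately have pos: "0 < fst a" "0 < snd a" using nn by auto
  have sub: "F \<subseteq> argmin_face a ?Q"
    using a(2) const FQ by (auto simp: argmin_face_def)
  have "argmin_face a ?Q \<subseteq> argmin_face a (convex hull S)"
  proof
    fix z assume z: "z \<in> argmin_face a ?Q"
    then obtain p t where pt: "z = p + t" "p \<in> convex hull S" "0 \<le> fst t" "0 \<le> snd t"
      unfolding argmin_face_def quadrant_hull_eq by blast
    have "a \<bullet> p \<le> a \<bullet> z"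
      using pos pt by (simp add: inner_prod_def algebra_simps)
    then have "p \<in> argmin_face a (convex hull S)"
      using z pt(2) hull_subset_quadrant_hull by (force simp: argmin_face_def)
    then show "z \<in> argmin_face a (convex hull S)"
      using argmin_face_quadrant_hull[OF pos] z by blast
  qed
  then show thesis using that pos sub by blast
qed

text \<open>This trades edges of an unbounded set for minimizing faces of the bounded hull, a
  description that is easily pulled back along an affine map. Asking for two distinct points
  discards the faces that are single vertices.\<close>

lemma compact_edges_quadrant_hull:
  assumes "finite S" "interior (convex hull S) \<noteq> {}"
  shows "\<Union>{F. F edge_of quadrant_hull S \<and> compact F} =
    \<Union>{argmin_face a (convex hull S) |a. 0 < fst a \<and> 0 < snd a \<and>
        (\<exists>x y. x \<in> argmin_face a (convex hull S) \<and> y \<in> argmin_face a (convex hull S) \<and> x \<noteq> y)}"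
    (is "?L = ?R")
proof
  show "?L \<subseteq> ?R"
  proof
    fix z assume "z \<in> ?L"
    then obtain F where F: "F edge_of quadrant_hull S" "compact F" "z \<in> F" by blast
    obtain a where "0 < fst a" "0 < snd a" "F \<subseteq> argmin_face a (convex hull S)"
      using compact_edge_quadrant_hull_argmin[OF assms(2) F(1,2)] .
    moreover obtain x y where "x \<in> F" "y \<in> F" "x \<noteq> y"
      using edge_of_two_points[OF F(1)] .
    ultimately show "z \<in> ?R"
      using F(3) by (intro UnionI[of "argmin_face a (convex hull S)"] CollectI exI[of _ a] conjI refl
          exI[of _ x] exI[of _ y]) auto
  qed
  show "?R \<subseteq> ?L"
  proof
    fix z assume "z \<in> ?R"
    then obtain a x y where a: "0 < fst a" "0 < snd a"
      and xy: "x \<in> argmin_face a (convex hull S)" "y \<in> argmin_face a (convex hull S)" "x \<noteq> y"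
      and z: "z \<in> argmin_face a (convex hull S)" by auto
    have eq: "argmin_face a (quadrant_hull S) = argmin_face a (convex hull S)"
      using argmin_face_quadrant_hull a xy by blast
    have "a \<noteq> 0" using a by auto
    then have "argmin_face a (convex hull S) edge_of quadrant_hull S"
      using argmin_face_edge[OF convex_quadrant_hull, of a x S y] xy eq by simp
    moreover have "compact (argmin_face a (convex hull S))"
    proof -
      have "argmin_face a (convex hull S) face_of convex hull S"
        using argmin_face_edge[OF convex_convex_hull \<open>a \<noteq> 0\<close> xy] by (simp add: edge_of_def)
      then show ?thesis
        using face_of_imp_compact assms(1) finite_imp_compact_convex_hull convex_convex_hull by blast
    qed
    ultimately show "z \<in> ?L" using z by blast
  qed
qed

section \<open>Counterclockwise polygons\<close>

text \<open>A discrete intermediate value theorem, used to find the edge of the chain above or below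
  a given abscissa.\<close>

lemma decreasing_chain_crossing:
  fixes f :: "nat \<Rightarrow> 'a::linorder"
  assumes "h < M" "c \<le> f h" "f M \<le> c"
  shows "\<exists>i. h \<le> i \<and> i < M \<and> f (Suc i) \<le> c \<and> c \<le> f i"
  using assms
proof (induction M)
  case (Suc M)
  show ?case
  proof (cases "f M \<le> c \<and> h < M")
    case True
    then show ?thesis using Suc less_Suc_eq by blast
  next
    case False
    then have "c \<le> f M" using Suc.prems by (metis less_antisym linear)
    then show ?thesis using Suc.prems less_Suc_eq_le by blast
  qed
qed simp

lemma affine_le_on_convex_hull:
  fixes S :: "'a::real_inner set"
  assumes "z \<in> convex hull S" "\<And>s. s \<in> S \<Longrightarrow> a \<bullet> s \<le> c"
  shows "a \<bullet> z \<le> c"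
proof -
  have "convex hull S \<subseteq> {x. a \<bullet> x \<le> c}"
    using assms(2) by (intro hull_minimal) (auto simp: convex_halfspace_le)
  then show ?thesis using assms(1) by blast
qed

text \<open>The three orientations divided by their sum are the barycentric coordinates of the
  point, and their strict positivity is an open condition.\<close>

lemma interior_triangle:
  assumes "convex P" "A \<in> P" "B \<in> P" "C \<in> P"
    and "orient A B w > 0" "orient B C w > 0" "orient C A w > 0"
  shows "w \<in> interior P"
proof -
  let ?O = "{w. orient A B w > 0 \<and> orient B C w > 0 \<and> orient C A w > 0}"
  have "open ?O"
    unfolding orient_def by (intro open_Collect_conj open_Collect_less continuous_intros)
  moreover have "?O \<subseteq> P"
  proof
    fix v assume v: "v \<in> ?O"
    define D where "D = orient B C v + orient C A v + orient A B v"
    have D: "D > 0" using v by (simp add: D_def)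
    have "orient B C v *\<^sub>R A + orient C A v *\<^sub>R B + orient A B v *\<^sub>R C = D *\<^sub>R v"
      unfolding D_def orient_def by (simp add: prod_eq_iff algebra_simps)
    then have "v = (1 / D) *\<^sub>R (orient B C v *\<^sub>R A + orient C A v *\<^sub>R B + orient A B v *\<^sub>R C)"
      using D by simp
    also have "\<dots> = (orient B C v / D) *\<^sub>R A + (orient C A v / D) *\<^sub>R B + (orient A B v / D) *\<^sub>R C"
      by (simp add: scaleR_add_right)
    finally have eq: "v = (orient B C v / D) *\<^sub>R A + (orient C A v / D) *\<^sub>R B + (orient A B v / D) *\<^sub>R C" .
    have sum1: "orient B C v / D + orient C A v / D + orient A B v / D = 1"
      using D unfolding D_def by (simp flip: add_divide_distrib)
    have "v \<in> convex hull {A, B, C}"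
      unfolding convex_hull_3
      using eq sum1 D v by (intro CollectI exI[of _ "orient B C v / D"] exI[of _ "orient C A v / D"]
          exI[of _ "orient A B v / D"]) auto
    moreover have "convex hull {A, B, C} \<subseteq> P"
      using assms by (intro hull_minimal) auto
    ultimately show "v \<in> P" by blast
  qed
  ultimately show ?thesis
    using assms by (intro interiorI[of ?O]) auto
qed

locale ccw_polygon =
  fixes S :: "(real \<times> real) set" and ps :: "(real \<times> real) list"
  assumes finite: "finite S"
    and length_ge_2: "2 \<le> length ps"
    and distinct: "distinct ps"
    and vertices: "set ps = {v. v extreme_point_of convex hull S}"
    and first: "\<And>s. s \<in> S \<Longrightarrow> fst (ps ! 0) < fst s \<or> (fst (ps ! 0) = fst s \<and> snd (ps ! 0) \<le> snd s)"
    and left: "\<And>i q. i < length ps \<Longrightarrow> q \<in> convex hull S \<Longrightarrow>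
      0 \<le> orient (ps ! i) (ps ! (Suc i mod length ps)) q"
begin

abbreviation "P \<equiv> convex hull S"

abbreviation "N \<equiv> length ps"

text \<open>Indices count modulo \<open>N\<close>: \<open>Suc\<close> is always the cyclic
  successor, and \<open>N\<close> names the first vertex as the end of the last edge.\<close>

definition vert :: "nat \<Rightarrow> real \<times> real" where
  "vert i = ps ! (i mod N)"

definition dx :: "nat \<Rightarrow> real" where
  "dx i = fst (vert (Suc i)) - fst (vert i)"

definition dy :: "nat \<Rightarrow> real" where
  "dy i = snd (vert (Suc i)) - snd (vert i)"

abbreviation "edge i \<equiv> closed_segment (vert i) (vert (Suc i))"

lemma N_pos: "0 < N"
  using length_ge_2 by linarith

lemma compact_P: "compact P"
  using finite finite_imp_compact_convex_hull by blast

lemma vert_in_set: "vert i \<in> set ps"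
  using N_pos by (simp add: vert_def)

lemma vert_extreme: "vert i extreme_point_of P"
  using vert_in_set vertices by blast

lemma vert_in_P: "vert i \<in> P"
  using vert_extreme by (simp add: extreme_point_of_def)

lemma vert_in_S: "vert i \<in> S"
  using vert_extreme extreme_point_of_convex_hull by blast

lemma vert_N: "vert N = vert 0"
  by (simp add: vert_def)

lemma vert_eq_iff: "vert i = vert j \<longleftrightarrow> i mod N = j mod N"
  unfolding vert_def using distinct N_pos by (simp add: nth_eq_iff_index_eq)

lemma vert_Suc_neq: "vert (Suc i) \<noteq> vert i"
  unfolding vert_eq_iff using length_ge_2 by (simp add: mod_Suc)

lemma edge_subset_P: "edge i \<subseteq> P"
  using vert_in_P closed_segment_subset convex_convex_hull by blast

lemma left_of_edge:
  assumes "q \<in> P"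
  shows "0 \<le> dx i * (snd q - snd (vert i)) - dy i * (fst q - fst (vert i))"
proof -
  have "0 \<le> orient (vert i) (vert (Suc i)) q"
    using left[of "i mod N" q] assms N_pos by (simp add: vert_def mod_Suc_eq)
  then show ?thesis by (simp add: orient_def dx_def dy_def)
qed

text \<open>The end of the next edge lies to the left of the current one; the cross product of an
  edge with itself drops out.\<close>

lemma turn_left: "0 \<le> dx i * dy (Suc i) - dy i * dx (Suc i)"
proof -
  have "0 \<le> dx i * (dy (Suc i) + dy i) - dy i * (dx (Suc i) + dx i)"
    using left_of_edge[OF vert_in_P, of i "Suc (Suc i)"] by (simp add: dx_def dy_def)
  then show ?thesis by (simp add: algebra_simps)
qed

lemma leftmost: "z \<in> P \<Longrightarrow> fst (vert 0) \<le> fst z"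
  using affine_le_on_convex_hull[of z S "(-1,0)" "- fst (vert 0)"] first
  by (force simp: vert_def inner_prod_def)

lemma first_vert:
  "fst (vert 0) < fst (vert i) \<or> (fst (vert 0) = fst (vert i) \<and> snd (vert 0) \<le> snd (vert i))"
  using first[OF vert_in_S] by (simp add: vert_def)

lemma not_collinear:
  assumes "interior P \<noteq> {}" "(a, b) \<noteq> (0, 0)"
  shows "\<exists>z\<in>P. a * fst z + b * snd z \<noteq> c"
  using not_constant_on_nonempty_interior[of "(a, b)" P c] assms
  by (auto simp: inner_prod_def zero_prod_def)

text \<open>A vertical next edge must go down, and then it runs in the leftmost column, whose lowest
  point is the first vertex. A rightward next edge would make the common vertex the first one, but
  its index lies strictly between \<open>0\<close> and \<open>N\<close>.\<close>

lemma next_edge_of_leftward_edge: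
  assumes int: "interior P \<noteq> {}" and dx: "dx i < 0" and i: "Suc i < N"
  shows "dx (Suc i) < 0 \<or> (dx (Suc i) = 0 \<and> dy (Suc i) < 0 \<and> Suc (Suc i) = N)"
proof -
  let ?v = "vert (Suc i)"
  have base: "0 \<le> dx i * (snd r - snd ?v) - dy i * (fst r - fst ?v)" if "r \<in> P" for r
    using left_of_edge[OF that, of i] by (simp add: dx_def dy_def algebra_simps)
  have nxt: "0 \<le> dx (Suc i) * (snd r - snd ?v) - dy (Suc i) * (fst r - fst ?v)" if "r \<in> P" for r
    using left_of_edge[OF that, of "Suc i"] .
  have ne0: "vert 0 \<noteq> ?v"
    unfolding vert_eq_iff using i by simp
  consider "dx (Suc i) < 0" | "dx (Suc i) = 0" | "dx (Suc i) > 0" by linarith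
  then show ?thesis
  proof cases
    case 1
    then show ?thesis by simp
  next
    case 2
    have "dx i * dy (Suc i) \<ge> 0" using turn_left[of i] 2 by simp
    then have "dy (Suc i) \<le> 0" using dx by (simp add: zero_le_mult_iff)
    moreover have "dy (Suc i) \<noteq> 0"
      using vert_Suc_neq[of "Suc i"] 2 by (auto simp: dx_def dy_def prod_eq_iff)
    ultimately have dy: "dy (Suc i) < 0" by simp
    \<comment> \<open>The left side of a downward edge is the east, so this edge lies in the
      leftmost column.\<close>
    have "fst ?v \<le> fst (vert 0)"
      using nxt[OF vert_in_P, of 0] 2 dy by (simp add: mult_le_0_iff)
    moreover have "fst (vert 0) \<le> fst ?v" using leftmost vert_in_P by blast
    ultimately have f0: "fst (vert 0) = fst ?v" by simp
    let ?w = "vert (Suc (Suc i))"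
    have fw: "fst ?w = fst ?v" using 2 by (simp add: dx_def)
    have sw: "snd ?w < snd ?v" using dy by (simp add: dy_def)
    have s0: "snd (vert 0) \<le> snd ?w" using first_vert[of "Suc (Suc i)"] f0 fw by simp
    \<comment> \<open>Otherwise \<open>?w\<close> lies strictly between \<open>vert 0\<close> and
      \<open>?v\<close> on the column and is not extreme.\<close>
    have "?w = vert 0"
    proof (rule ccontr)
      assume "?w \<noteq> vert 0"
      then have s0': "snd (vert 0) < snd ?w"
        using s0 f0 fw by (auto simp: prod_eq_iff)
      define u where "u = (snd ?w - snd (vert 0)) / (snd ?v - snd (vert 0))"
      have u: "0 < u" "u < 1" using s0' sw by (auto simp: u_def)
      have "u * (snd ?v - snd (vert 0)) = snd ?w - snd (vert 0)"
        using s0' sw by (simp add: u_def)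
      then have "snd ?w = (1 - u) * snd (vert 0) + u * snd ?v"
        by (simp add: algebra_simps)
      then have "?w = (1 - u) *\<^sub>R vert 0 + u *\<^sub>R ?v"
        using f0 fw by (simp add: prod_eq_iff algebra_simps)
      then have "?w \<in> open_segment (vert 0) ?v"
        using ne0 u by (auto simp: in_segment)
      then show False
        using vert_extreme[of "Suc (Suc i)"] vert_in_P by (auto simp: extreme_point_of_def)
    qed
    then have "Suc (Suc i) mod N = 0" unfolding vert_eq_iff by simp
    then have "Suc (Suc i) = N" using i
      by (metis Suc_lessI mod_less nat.distinct(1))
    then show ?thesis using 2 dy by simp
  next
    case 3
    \<comment> \<open>A left turn from a leftward into a rightward edge happens at the first vertex only.\<close>
    have "dx i * dy (Suc i) - dy i * dx (Suc i) \<noteq> 0"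
    proof
      \<comment> \<open>The two edges would be antiparallel, and the half planes to their left share
        only the common line, which cannot contain a set with interior points.\<close>
      assume eq: "dx i * dy (Suc i) - dy i * dx (Suc i) = 0"
      have "(- dy i, dx i) \<noteq> (0, 0)" using dx by auto
      then obtain r where r: "r \<in> P"
        "- dy i * fst r + dx i * snd r \<noteq> dx i * snd ?v - dy i * fst ?v"
        using not_collinear[OF int] by blast
      define x y where "x = fst r - fst ?v" and "y = snd r - snd ?v"
      have "dx i * y - dy i * x > 0"
        using base[OF r(1)] r(2) unfolding x_def y_def by (simp add: algebra_simps)
      then have "dx (Suc i) * (dx i * y - dy i * x) > 0" using 3 by simp
      moreover have "dx i * (dx (Suc i) * y - dy (Suc i) * x) \<le> 0"
        using nxt[OF r(1)] dx unfolding x_def y_def by (simp add: mult_nonpos_nonneg)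
      moreover have "dx (Suc i) * (dx i * y - dy i * x) =
        dx i * (dx (Suc i) * y - dy (Suc i) * x) + (dx i * dy (Suc i) - dy i * dx (Suc i)) * x"
        by (simp add: algebra_simps)
      ultimately show False using eq by simp
    qed
    then have cross: "dx i * dy (Suc i) - dy i * dx (Suc i) > 0"
      using turn_left[of i] by simp
    define x y where "x = fst (vert 0) - fst ?v" and "y = snd (vert 0) - snd ?v"
    have x: "x < 0 \<or> (x = 0 \<and> y < 0)"
      using first_vert[of "Suc i"] ne0 unfolding x_def y_def by (auto simp: prod_eq_iff)
    have b: "0 \<le> dx i * y - dy i * x" and n: "0 \<le> dx (Suc i) * y - dy (Suc i) * x"
      using base[OF vert_in_P, of 0] nxt[OF vert_in_P, of 0] unfolding x_def y_def by auto
    \<comment> \<open>Weighted by \<open>dx (Suc i)\<close> and by \<open>dx i\<close>, the two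
      half-plane inequalities have the same term in \<open>y\<close>; subtracting leaves the cross
      product times \<open>x\<close>.\<close>
    have "0 \<le> dx (Suc i) * (dx i * y - dy i * x)" "dx i * (dx (Suc i) * y - dy (Suc i) * x) \<le> 0"
      using b n 3 dx by (auto simp: mult_nonpos_nonneg)
    then have "0 \<le> (dx i * dy (Suc i) - dy i * dx (Suc i)) * x"
      by (simp add: algebra_simps)
    then have "x \<ge> 0" using cross by (simp add: zero_le_mult_iff)
    then have "x = 0" "y < 0" using x by auto
    then have "dx (Suc i) * y \<ge> 0" using n by simp
    then show ?thesis using 3 \<open>y < 0\<close> by (simp add: zero_le_mult_iff)
  qed
qed

section \<open>Edges inside and outside the upper boundary\<close>

lemma frontier_P: "frontier P = P - interior P"
  using compact_imp_closed[OF compact_P] by (simp add: frontier_def)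

text \<open>Points of the polytope close to the midpoint of the edge either lie in the leftmost
  column, hence on the frontier of the quadrant hull, or are interior to a triangle with the edge as
  a side. So the midpoint is not in the closure.\<close>

lemma vertical_edge_not_upper:
  assumes int: "interior P \<noteq> {}" and dx: "dx i = 0" and dy: "dy i < 0"
  shows "\<not> edge i \<subseteq> closure (frontier P - frontier (quadrant_hull S))"
proof
  assume sub: "edge i \<subseteq> closure (frontier P - frontier (quadrant_hull S))"
  let ?A = "vert i" and ?B = "vert (Suc i)"
  have fB: "fst ?B = fst ?A" and sB: "snd ?B < snd ?A"
    using dx dy by (auto simp: dx_def dy_def)
  have min: "fst ?A \<le> fst r" if "r \<in> P" for r
    using left_of_edge[OF that, of i] dx dy by (simp add: mult_le_0_iff)
  obtain C where C: "C \<in> P" "1 * fst C + 0 * snd C \<noteq> fst ?A"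
    using not_collinear[OF int, of 1 0 "fst ?A"] by auto
  then have fC: "fst ?A < fst C" using min[of C] by simp
  let ?z = "midpoint ?A ?B"
  have fz: "fst ?z = fst ?A" and sz: "snd ?z = (snd ?A + snd ?B) / 2"
    using fB by (auto simp: midpoint_def)
  \<comment> \<open>The other two sides of the triangle cut out an open neighbourhood of the
    midpoint.\<close>
  let ?O = "{w. orient ?B C w > 0 \<and> orient C ?A w > 0}"
  have "open ?O"
    unfolding orient_def by (intro open_Collect_conj open_Collect_less continuous_intros)
  moreover have "?z \<in> ?O"
  proof -
    have "orient ?B C ?z = (fst C - fst ?A) * ((snd ?A - snd ?B) / 2)"
      unfolding orient_def fz sz fB by (simp add: field_simps)
    moreover have "orient C ?A ?z = (fst C - fst ?A) * ((snd ?A - snd ?B) / 2)"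
      unfolding orient_def fz sz by (simp add: field_simps)
    moreover have "0 < (fst C - fst ?A) * ((snd ?A - snd ?B) / 2)"
      using fC sB by simp
    ultimately show ?thesis by (simp only: mem_Collect_eq)
  qed
  moreover have "?z \<in> closure (frontier P - frontier (quadrant_hull S))"
    using sub midpoint_in_closed_segment by blast
  ultimately have "?O \<inter> (frontier P - frontier (quadrant_hull S)) \<noteq> {}"
    using open_Int_closure_eq_empty[of ?O "frontier P - frontier (quadrant_hull S)"] by blast
  then obtain w where w: "w \<in> ?O" "w \<in> frontier P" "w \<notin> frontier (quadrant_hull S)"
    by blast
  have wP: "w \<in> P" "w \<notin> interior P" using w frontier_P by auto
  show False
  proof (cases "fst w = fst ?A")
    case True
    then show False
      using leftmost_in_frontier_quadrant_hull[OF wP(1)] min w(3) by auto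
  next
    case False
    then have "orient ?A ?B w > 0"
      using min[OF wP(1)] fB sB by (auto simp: orient_def mult_less_0_iff)
    then show False
      using interior_triangle[OF convex_convex_hull vert_in_P vert_in_P C(1)] w(1) wP(2) by blast
  qed
qed

text \<open>Only the open edge is shown to avoid the frontier of the quadrant hull. An end point in
  the leftmost column does lie on that frontier and is recovered by the closure.\<close>

lemma leftward_edge_upper:
  assumes int: "interior P \<noteq> {}" and dx: "dx i < 0"
  shows "edge i \<subseteq> closure (frontier P - frontier (quadrant_hull S))"
proof -
  have "open_segment (vert i) (vert (Suc i)) \<subseteq> frontier P - frontier (quadrant_hull S)"
  proof
    \<comment> \<open>A nonnegative form supporting at an inner point of the edge would be a positive multiple of
      the inner normal, whose second coordinate is negative.\<close>
    fix w assume "w \<in> open_segment (vert i) (vert (Suc i))"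
    then obtain u where u: "0 < u" "u < 1" "w = (1 - u) *\<^sub>R vert i + u *\<^sub>R vert (Suc i)"
      by (auto simp: in_segment)
    have wP: "w \<in> P" using edge_subset_P[of i] u
      by (intro subsetD[of "edge i" P w]) (auto simp: in_segment intro!: exI[of _ u])
    have fw: "fst w = fst (vert i) + u * dx i" and sw: "snd w = snd (vert i) + u * dy i"
      by (auto simp: u(3) dx_def dy_def algebra_simps)
    have "w \<notin> interior P"
    proof (rule minimizer_not_in_interior[of "(- dy i, dx i)"])
      show "(- dy i, dx i) \<noteq> 0" using dx by (auto simp: zero_prod_def)
      show "(- dy i, dx i) \<bullet> w \<le> (- dy i, dx i) \<bullet> y" if "y \<in> P" for y
        using left_of_edge[OF that, of i] fw sw by (simp add: inner_prod_def algebra_simps)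
    qed
    moreover have "w \<notin> frontier (quadrant_hull S)"
    proof
      assume "w \<in> frontier (quadrant_hull S)"
      then obtain a where a: "a \<noteq> 0" "0 \<le> fst a" "0 \<le> snd a" "\<And>z. z \<in> P \<Longrightarrow> a \<bullet> w \<le> a \<bullet> z"
        using frontier_quadrant_hullE wP by blast
      have *: "fst a * fst w + snd a * snd w \<le> fst a * fst z + snd a * snd z" if "z \<in> P" for z
        using a(4)[OF that] by (simp add: inner_prod_def)
      let ?e = "fst a * dx i + snd a * dy i"
      have "u * ?e \<le> 0"
        using *[OF vert_in_P, of i] unfolding fw sw by (simp add: algebra_simps)
      moreover have "0 \<le> (1 - u) * ?e"
        using *[OF vert_in_P, of "Suc i"] unfolding fw sw by (simp add: dx_def dy_def algebra_simps)
      ultimately have e: "?e = 0"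
        using u by (simp add: mult_le_0_iff zero_le_mult_iff)
      have s0: "snd a > 0"
      proof (rule ccontr)
        assume "\<not> snd a > 0"
        then have "snd a = 0" using a(3) by simp
        then show False using e dx a(1) by (auto simp: prod_eq_iff)
      qed
      \<comment> \<open>The form is constant on the edge and \<open>snd a > 0 > dx i\<close>, so the
        polytope lies on the side where it is at most its value at \<open>w\<close>. Together with
        minimality at \<open>w\<close> it would be constant on the polytope, which \<open>r\<close>
        refutes.\<close>
      obtain r where r: "r \<in> P" "fst a * fst r + snd a * snd r \<noteq> fst a * fst w + snd a * snd w"
        using not_collinear[OF int, of "fst a" "snd a"] s0 by (metis Pair_inject less_irrefl)
      define x y where "x = fst r - fst (vert i)" and "y = snd r - snd (vert i)"
      have "0 \<le> dx i * y - dy i * x"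
        using left_of_edge[OF r(1)] unfolding x_def y_def .
      then have "0 \<le> snd a * (dx i * y - dy i * x)" using s0 by simp
      moreover have "snd a * dy i = - (fst a * dx i)" using e by simp
      then have "snd a * dy i * x = - (fst a * dx i) * x" by simp
      ultimately have "0 \<le> dx i * (fst a * x + snd a * y)"
        by (simp add: algebra_simps)
      then have "fst a * x + snd a * y \<le> 0"
        using dx by (simp add: zero_le_mult_iff)
      moreover have "fst a * fst w + snd a * snd w = fst a * fst (vert i) + snd a * snd (vert i) + u * ?e"
        unfolding fw sw by (simp add: algebra_simps)
      then have "fst a * fst w + snd a * snd w = fst a * fst (vert i) + snd a * snd (vert i)"
        using e by simp
      moreover have "fst a * fst w + snd a * snd w < fst a * fst r + snd a * snd r"
        using *[OF r(1)] r(2) by simp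
      ultimately show False unfolding x_def y_def by (simp add: algebra_simps)
    qed
    ultimately show "w \<in> frontier P - frontier (quadrant_hull S)"
      using wP frontier_P by simp
  qed
  then have "closure (open_segment (vert i) (vert (Suc i))) \<subseteq> closure (frontier P - frontier (quadrant_hull S))"
    by (rule closure_mono)
  then show ?thesis using vert_Suc_neq[of i] by (simp add: closure_open_segment)
qed

end

text \<open>The main segment is the edge \<open>h - 1\<close>, hence the range \<open>1..N\<close>.
  The value \<open>h = N\<close> occurs when the main vertex is the first vertex; no edge follows it
  then.\<close>

locale upper_main_polygon = ccw_polygon +
  fixes h :: nat and \<alpha> \<beta> \<delta> :: real
  assumes h: "1 \<le> h" "h \<le> N"
    and pos: "0 < \<alpha>" "0 < \<beta>"
    and line: "\<alpha> * fst (vert (h - 1)) + \<beta> * snd (vert (h - 1)) = \<delta>" "\<alpha> * fst (vert h) + \<beta> * snd (vert h) = \<delta>"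
    and top: "\<And>z. z \<in> P \<Longrightarrow> snd z \<le> snd (vert h)"
begin

text \<open>The edge ends at a highest point and lies on a line of negative slope, so it rises to
  the left. This starts the induction along the chain.\<close>

lemma main_edge: "dx (h - 1) < 0" "\<alpha> * dx (h - 1) + \<beta> * dy (h - 1) = 0"
proof -
  have Suc: "Suc (h - 1) = h" using h by simp
  show 0: "\<alpha> * dx (h - 1) + \<beta> * dy (h - 1) = 0"
    unfolding dx_def dy_def Suc using line by (simp add: algebra_simps)
  have "dy (h - 1) \<ge> 0"
    unfolding dy_def Suc using top[OF vert_in_P] by simp
  moreover have "dy (h - 1) \<noteq> 0"
  proof
    assume "dy (h - 1) = 0"
    moreover from this have "dx (h - 1) = 0" using 0 pos by simp
    ultimately show False
      using vert_Suc_neq[of "h - 1"] by (auto simp: dx_def dy_def prod_eq_iff)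
  qed
  ultimately have "\<beta> * dy (h - 1) > 0" using pos by simp
  then have "\<alpha> * dx (h - 1) < 0" using 0 by linarith
  then show "dx (h - 1) < 0" using pos by (simp add: mult_less_0_iff)
qed

text \<open>Eliminating \<open>dy (h - 1)\<close> by the equation of the line turns the half plane
  left of the main edge into the one below the line. This is the maximality of
  \<open>\<delta>\<close>, which keeps the exponents of \<open>v\<close> nonnegative.\<close>

lemma weight_le_main:
  assumes "z \<in> P"
  shows "\<alpha> * fst z + \<beta> * snd z \<le> \<delta>"
proof -
  define x y where "x = fst z - fst (vert (h - 1))" and "y = snd z - snd (vert (h - 1))"
  have "0 \<le> \<beta> * (dx (h - 1) * y - dy (h - 1) * x)"
    using left_of_edge[OF assms, of "h - 1"] pos unfolding x_def y_def by simp
  moreover have "\<beta> * dy (h - 1) = - (\<alpha> * dx (h - 1))" using main_edge(2) by simp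
  then have "\<beta> * dy (h - 1) * x = - (\<alpha> * dx (h - 1)) * x" by simp
  ultimately have "0 \<le> dx (h - 1) * (\<alpha> * x + \<beta> * y)" by (simp add: algebra_simps)
  then have "\<alpha> * x + \<beta> * y \<le> 0" using main_edge(1) by (simp add: zero_le_mult_iff)
  then show ?thesis using line(1) unfolding x_def y_def by (simp add: algebra_simps)
qed

text \<open>A vertical step ends at index \<open>N\<close>, so the induction never has to continue
  past one.\<close>

lemma left_chain:
  assumes int: "interior P \<noteq> {}" and "h \<le> i" "i < N"
  shows "dx i < 0 \<or> (dx i = 0 \<and> dy i < 0 \<and> Suc i = N)"
  using assms(2,3)
proof (induction i rule: dec_induct)
  case base
  then show ?case
    using next_edge_of_leftward_edge[OF int main_edge(1)] h by simp
next
  case (step i)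
  then show ?case
    using next_edge_of_leftward_edge[OF int, of i] by auto
qed

text \<open>The first edge goes left without rising, and a left turn between leftward edges
  preserves the sign. The negated quantity is the first coefficient of the form minimized along the
  image of the edge.\<close>

lemma left_chain_weight_decreasing:
  assumes int: "interior P \<noteq> {}" and "h \<le> i" "i < N" "dx i < 0"
  shows "\<alpha> * dx i + \<beta> * dy i < 0"
  using assms(2-)
proof (induction i rule: dec_induct)
  case base
  have "dy h \<le> 0" unfolding dy_def using top[OF vert_in_P] by simp
  then have "\<alpha> * dx h < 0" "\<beta> * dy h \<le> 0"
    using base pos by (auto simp: mult_less_0_iff mult_le_0_iff)
  then show ?case by linarith
next
  case (step i)
  have dxi: "dx i < 0" using left_chain[OF int, of i] step by auto
  then have "\<alpha> * dx i + \<beta> * dy i < 0" using step by simp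
  then have "0 < dx (Suc i) * (\<alpha> * dx i + \<beta> * dy i)"
    using step.prems by (simp add: mult_neg_neg)
  moreover have "0 \<le> \<beta> * (dx i * dy (Suc i) - dy i * dx (Suc i))"
    using turn_left[of i] pos by simp
  \<comment> \<open>The products with \<open>dy i * dx (Suc i)\<close> cancel when the two
    inequalities are added.\<close>
  ultimately have "0 < dx i * (\<alpha> * dx (Suc i) + \<beta> * dy (Suc i))"
    by (simp add: algebra_simps)
  then show ?case using dxi by (simp add: zero_less_mult_iff)
qed

lemma left_chain_upper_iff:
  assumes int: "interior P \<noteq> {}" and "h \<le> i" "i < N"
  shows "edge i \<subseteq> closure (frontier P - frontier (quadrant_hull S)) \<longleftrightarrow> dx i < 0"
  using left_chain[OF assms] vertical_edge_not_upper[OF int, of i] leftward_edge_upper[OF int, of i]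
  by blast

lemma edge_maximizes_outer_normal:
  assumes "z \<in> edge i" "w \<in> P"
  shows "dy i * fst w - dx i * snd w \<le> dy i * fst z - dx i * snd z"
proof -
  obtain u where u: "z = (1 - u) *\<^sub>R vert i + u *\<^sub>R vert (Suc i)"
    using assms(1) by (auto simp: in_segment)
  have "fst z = fst (vert i) + u * dx i" "snd z = snd (vert i) + u * dy i"
    by (auto simp: u dx_def dy_def algebra_simps)
  then show ?thesis using left_of_edge[OF assms(2), of i] by (simp add: algebra_simps)
qed

text \<open>The leftward edges after the main vertex cover all abscissae from the main vertex down
  to the leftmost column. A maximizer lies in that range, and as \<open>q > 0\<close> it lies on the
  edge found at its abscissa.\<close>

lemma maximal_face_in_left_chain:
  assumes int: "interior P \<noteq> {}" and q: "0 < q" "p * \<beta> < q * \<alpha>"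
    and max: "\<And>z w. z \<in> G \<Longrightarrow> w \<in> P \<Longrightarrow> p * fst w + q * snd w \<le> p * fst z + q * snd z"
    and G: "G \<subseteq> P" "x \<in> G" "y \<in> G" "x \<noteq> y" and z: "z \<in> G"
  shows "\<exists>i. h \<le> i \<and> i < N \<and> dx i < 0 \<and> z \<in> edge i"
proof -
  \<comment> \<open>Relative to the main vertex, \<open>p * a + q * b\<close> is nonnegative and the
    weight is nonpositive. Scaling by \<open>\<beta>\<close> and \<open>q\<close> and subtracting
    eliminates \<open>b\<close>.\<close>
  have le_h: "fst g \<le> fst (vert h)" if g: "g \<in> G" for g
  proof -
    define a b where "a = fst g - fst (vert h)" and "b = snd g - snd (vert h)"
    have "0 \<le> p * a + q * b"
      using max[OF g vert_in_P, of h] unfolding a_def b_def by (simp add: algebra_simps)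
    then have 1: "0 \<le> \<beta> * (p * a + q * b)" using pos by simp
    have "\<alpha> * a + \<beta> * b \<le> 0"
      using weight_le_main[of g] G(1) g line(2) unfolding a_def b_def by (auto simp: algebra_simps)
    then have "q * (\<alpha> * a + \<beta> * b) \<le> 0" using q by (simp add: mult_le_0_iff)
    then have "0 \<le> (p * \<beta> - q * \<alpha>) * a" using 1 by (simp add: algebra_simps)
    then have "a \<le> 0" using q by (simp add: zero_le_mult_iff)
    then show ?thesis by (simp add: a_def)
  qed
  \<comment> \<open>Otherwise \<open>G\<close> lies in a single column, where \<open>q > 0\<close>
    makes the form injective, although it takes one value at \<open>x\<close> and
    \<open>y\<close>.\<close>
  have not_leftmost: "fst (vert h) \<noteq> fst (vert 0)"
  proof
    assume eq: "fst (vert h) = fst (vert 0)"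
    have f: "fst g = fst (vert 0)" if "g \<in> G" for g
      using le_h[OF that] leftmost[of g] G(1) that eq by auto
    have "p * fst x + q * snd x = p * fst y + q * snd y"
      using max[of x y] max[of y x] G by (intro antisym) auto
    then have "snd x = snd y" using f[OF G(2)] f[OF G(3)] q by simp
    then show False using f[OF G(2)] f[OF G(3)] G(4) by (simp add: prod_eq_iff)
  qed
  \<comment> \<open>\<open>M\<close> is where the chain reaches the leftmost column:
    \<open>N - 1\<close> if a step down the column follows, otherwise \<open>N\<close>.\<close>
  obtain M where M: "h < M" "M \<le> N" "fst (vert M) = fst (vert 0)" "\<And>i. h \<le> i \<Longrightarrow> i < M \<Longrightarrow> dx i < 0"
  proof -
    have hN: "h < N" using not_leftmost h vert_N by (metis le_neq_implies_less)
    show thesis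
    proof (cases "dx (N - 1) < 0")
      case True
      then have "dx i < 0" if "h \<le> i" "i < N" for i
        using left_chain[OF int that] True by (metis diff_Suc_1 less_irrefl)
      then show thesis using that[of N] hN vert_N by simp
    next
      case False
      then have "dx (N - 1) = 0" using left_chain[OF int, of "N - 1"] hN by auto
      then have f: "fst (vert (N - 1)) = fst (vert 0)"
        using hN vert_N Suc_diff_1[OF N_pos] by (metis dx_def eq_iff_diff_eq_0)
      then have "h \<noteq> N - 1" using not_leftmost by auto
      moreover have "dx i < 0" if "h \<le> i" "i < N - 1" for i
        using left_chain[OF int, of i] that by (cases "Suc i = N") auto
      ultimately show thesis using that[of "N - 1"] hN f by simp
    qed
  qed
  have "fst (vert M) \<le> fst z" using M(3) leftmost[of z] G(1) z by auto
  then obtain i where i: "h \<le> i" "i < M" "fst (vert (Suc i)) \<le> fst z" "fst z \<le> fst (vert i)"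
    using decreasing_chain_crossing[of h M "fst z" "\<lambda>i. fst (vert i)"] M(1) le_h[OF z] by blast
  have dxi: "dx i < 0" using M(4) i by blast
  \<comment> \<open>The point of the edge above or below \<open>z\<close> cannot be higher than \<open>z\<close>, which is maximal for \<open>(p, q)\<close>,
    nor lower, because \<open>z\<close> lies to the left of the edge.\<close>
  define u where "u = (fst z - fst (vert i)) / dx i"
  have udx: "u * dx i = fst z - fst (vert i)" using dxi by (simp add: u_def)
  have u0: "0 \<le> u" using i dxi by (simp add: u_def divide_nonpos_neg)
  have u1: "u \<le> 1"
    using i dxi by (simp add: u_def neg_divide_le_eq dx_def)
  let ?e = "(1 - u) *\<^sub>R vert i + u *\<^sub>R vert (Suc i)"
  have fe: "fst ?e = fst z" and se: "snd ?e = snd (vert i) + u * dy i"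
    using udx by (auto simp: dx_def dy_def algebra_simps)
  have eE: "?e \<in> edge i" using u0 u1 by (auto simp: in_segment)
  then have "q * snd ?e \<le> q * snd z"
    using max[OF z, of ?e] edge_subset_P[of i] fe by auto
  then have "snd ?e \<le> snd z" using q by simp
  moreover have "snd z \<le> snd ?e"
  proof -
    have "0 \<le> dx i * (snd z - snd (vert i)) - dy i * (u * dx i)"
      using left_of_edge[of z i] G z udx by auto
    then have "0 \<le> dx i * (snd z - snd ?e)" unfolding se by (simp add: algebra_simps)
    then show ?thesis using dxi by (simp add: zero_le_mult_iff)
  qed
  ultimately have "z = ?e" using fe by (simp add: prod_eq_iff)
  then show ?thesis using eE i M(2) dxi by auto
qed

end

section \<open>The support of the compactified field\<close>

lemma mem_vf_support: "(m, n) \<in> vf_support X \<longleftrightarrow> a_coeff X m n \<noteq> 0 \<or> b_coeff X m n \<noteq> 0"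
  by (simp add: vf_support_def sum_power2_eq_zero_iff)

lemma vf_support_ge: "(m, n) \<in> vf_support X \<Longrightarrow> -1 \<le> m \<and> -1 \<le> n"
  by (auto simp: mem_vf_support a_coeff_def b_coeff_def split: if_splits)

lemma finite_poly_poly_support: "finite {(i, j). coeff (coeff p j) i \<noteq> (0::real)}"
proof -
  have "{(i, j). coeff (coeff p j) i \<noteq> 0} \<subseteq> (\<Union>j\<le>degree p. {..degree (coeff p j)} \<times> {j})"
  proof clarify
    fix i j assume nz: "coeff (coeff p j) i \<noteq> 0"
    then have "coeff p j \<noteq> 0" by auto
    then have "j \<le> degree p" "i \<le> degree (coeff p j)" using nz by (auto intro: le_degree)
    then show "(i, j) \<in> (\<Union>j\<le>degree p. {..degree (coeff p j)} \<times> {j})" by blast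
  qed
  then show ?thesis by (rule finite_subset) auto
qed

lemma finite_vf_support: "finite (vf_support X)"
proof -
  let ?A = "(\<lambda>(i, j). (int i - 1, int j)) ` {(i, j). coeff (coeff (fst X) j) i \<noteq> 0}"
  let ?B = "(\<lambda>(i, j). (int i, int j - 1)) ` {(i, j). coeff (coeff (snd X) j) i \<noteq> 0}"
  have "vf_support X \<subseteq> ?A \<union> ?B"
  proof clarify
    fix m n assume "(m, n) \<in> vf_support X" and notB: "(m, n) \<notin> ?B"
    then consider "a_coeff X m n \<noteq> 0" | "b_coeff X m n \<noteq> 0" by (auto simp: mem_vf_support)
    then show "(m, n) \<in> ?A"
    proof cases
      case 1
      then show ?thesis
        by (intro image_eqI[of _ _ "(nat (m + 1), nat n)"]) (auto simp: a_coeff_def split: if_splits)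
    next
      case 2
      then have "(m, n) \<in> ?B"
        by (intro image_eqI[of _ _ "(nat m, nat (n + 1))"]) (auto simp: b_coeff_def split: if_splits)
      then show ?thesis using notB by simp
    qed
  qed
  then show ?thesis
    by (rule finite_subset) (simp add: finite_poly_poly_support)
qed

lemma coeff_coeff_sum_monom:
  "coeff (coeff (\<Sum>p\<in>A. monom (monom (f p) (i p)) (j p)) k) l =
    (\<Sum>p\<in>A. if j p = k \<and> i p = l then f p else 0)"
  unfolding coeff_sum by (intro sum.cong) (auto simp: coeff_monom)

context
  fixes X :: poly_vf and \<alpha> \<beta> \<delta> :: int
  assumes \<beta>: "0 < \<beta>"
    and weight: "\<forall>(m, n)\<in>vf_support X. \<alpha> * m + \<beta> * n \<le> \<delta>"
begin

lemma weight_le: "(m, n) \<in> vf_support X \<Longrightarrow> \<alpha> * m + \<beta> * n \<le> \<delta>"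
  using weight by blast

text \<open>The point is the truncation by \<open>nat\<close>: on the support both of its arguments
  are nonnegative, so equal truncations mean equal exponents.\<close>

lemma a_coeff_y_compactification_sum:
  "a_coeff (y_compactification \<alpha> \<beta> \<delta> X) M K =
    (\<Sum>p\<in>vf_support X. if fst p = M \<and> \<delta> - (\<alpha> * fst p + \<beta> * snd p) = K
      then a_coeff X (fst p) (snd p) - real_of_int \<alpha> / real_of_int \<beta> * b_coeff X (fst p) (snd p) else 0)"
proof (cases "M < -1 \<or> K \<le> -1")
  case True
  then have "\<not> (fst p = M \<and> \<delta> - (\<alpha> * fst p + \<beta> * snd p) = K)" if "p \<in> vf_support X" for p
    using vf_support_ge[of "fst p" "snd p" X] weight_le[of "fst p" "snd p"] that by auto
  note no_term = this
  have zero: "a_coeff (y_compactification \<alpha> \<beta> \<delta> X) M K = 0"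
    using True by (simp add: a_coeff_def)
  show ?thesis
    unfolding zero by (intro sum.neutral[symmetric] ballI if_not_P no_term)
next
  case False
  have eq: "nat (\<delta> - (\<alpha> * fst p + \<beta> * snd p)) = nat K \<and> nat (fst p + 1) = nat (M + 1) \<longleftrightarrow>
      fst p = M \<and> \<delta> - (\<alpha> * fst p + \<beta> * snd p) = K" if "p \<in> vf_support X" for p
    using that False vf_support_ge[of "fst p" "snd p" X] weight_le[of "fst p" "snd p"]
    by (simp add: eq_nat_nat_iff conj_commute)
  have "a_coeff (y_compactification \<alpha> \<beta> \<delta> X) M K =
      coeff (coeff (fst (y_compactification \<alpha> \<beta> \<delta> X)) (nat K)) (nat (M + 1))"
    using False by (simp add: a_coeff_def)
  then show ?thesis
    unfolding y_compactification_def fst_conv case_prod_unfold coeff_coeff_sum_monom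
    using eq by (simp only: cong: sum.cong)
qed

lemma b_coeff_y_compactification_sum:
  "b_coeff (y_compactification \<alpha> \<beta> \<delta> X) M K =
    (\<Sum>p\<in>vf_support X. if fst p = M \<and> \<delta> - (\<alpha> * fst p + \<beta> * snd p) = K
      then - (1 / real_of_int \<beta>) * b_coeff X (fst p) (snd p) else 0)"
proof (cases "M \<le> -1 \<or> K < -1")
  case True
  then have "(if fst p = M \<and> \<delta> - (\<alpha> * fst p + \<beta> * snd p) = K
      then - (1 / real_of_int \<beta>) * b_coeff X (fst p) (snd p) else 0) = 0" if "p \<in> vf_support X" for p
    using weight_le[of "fst p" "snd p"] that by (auto simp: b_coeff_def)
  then show ?thesis
    using True by (simp add: b_coeff_def[of "y_compactification \<alpha> \<beta> \<delta> X"])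
next
  case False
  have eq: "(if nat (\<delta> - (\<alpha> * fst p + \<beta> * snd p) + 1) = nat (K + 1) \<and> nat (fst p) = nat M
      then - (1 / real_of_int \<beta>) * b_coeff X (fst p) (snd p) else 0) =
      (if fst p = M \<and> \<delta> - (\<alpha> * fst p + \<beta> * snd p) = K
      then - (1 / real_of_int \<beta>) * b_coeff X (fst p) (snd p) else 0)" if p: "p \<in> vf_support X" for p
  proof (cases "fst p \<le> -1")
    case True
    \<comment> \<open>At abscissa \<open>-1\<close> the function \<open>nat\<close> gives
      \<open>0\<close>, as it does at abscissa \<open>0\<close>; the vanishing coefficient makes the
      confusion harmless.\<close>
    then have "b_coeff X (fst p) (snd p) = 0" by (simp add: b_coeff_def)
    then show ?thesis by (simp only: mult_zero_right if_cancel)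
  next
    case nonneg: False
    then have "nat (\<delta> - (\<alpha> * fst p + \<beta> * snd p) + 1) = nat (K + 1) \<and> nat (fst p) = nat M \<longleftrightarrow>
        fst p = M \<and> \<delta> - (\<alpha> * fst p + \<beta> * snd p) = K"
      using False weight_le[of "fst p" "snd p"] p by (simp add: eq_nat_nat_iff conj_commute)
    then show ?thesis by simp
  qed
  have "b_coeff (y_compactification \<alpha> \<beta> \<delta> X) M K =
      coeff (coeff (snd (y_compactification \<alpha> \<beta> \<delta> X)) (nat (K + 1))) (nat M)"
    using False by (simp add: b_coeff_def)
  then show ?thesis
    unfolding y_compactification_def snd_conv case_prod_unfold coeff_coeff_sum_monom
    using sum.cong[OF refl eq] by simp
qed

text \<open>Since \<open>\<beta>\<close> is nonzero, the exponents determine the monomial of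
  \<open>X\<close> they come from. No two terms merge or cancel, and the sums above reduce to one
  term.\<close>

lemma exponent_pair_eq_iff:
  "fst p = m \<and> \<delta> - (\<alpha> * fst p + \<beta> * snd p) = \<delta> - (\<alpha> * m + \<beta> * n) \<longleftrightarrow> p = (m, n)"
  using \<beta> by (auto simp: prod_eq_iff)

lemma a_coeff_y_compactification:
  "a_coeff (y_compactification \<alpha> \<beta> \<delta> X) m (\<delta> - (\<alpha> * m + \<beta> * n)) =
    a_coeff X m n - real_of_int \<alpha> / real_of_int \<beta> * b_coeff X m n"
  unfolding a_coeff_y_compactification_sum exponent_pair_eq_iff
  using finite_vf_support[of X] mem_vf_support[of m n X] by auto

lemma b_coeff_y_compactification:
  "b_coeff (y_compactification \<alpha> \<beta> \<delta> X) m (\<delta> - (\<alpha> * m + \<beta> * n)) =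
    - (1 / real_of_int \<beta>) * b_coeff X m n"
  unfolding b_coeff_y_compactification_sum exponent_pair_eq_iff
  using finite_vf_support[of X] mem_vf_support[of m n X] by auto

text \<open>The coefficient pairs change by an invertible triangular matrix, so a pair vanishes
  after the change iff it did before.\<close>

lemma vf_support_y_compactification:
  "vf_support (y_compactification \<alpha> \<beta> \<delta> X) = (\<lambda>(m, n). (m, \<delta> - (\<alpha> * m + \<beta> * n))) ` vf_support X"
proof (intro equalityI subsetI)
  fix q assume q: "q \<in> vf_support (y_compactification \<alpha> \<beta> \<delta> X)"
  obtain M K where MK: "q = (M, K)" by fastforce
  have "\<exists>p\<in>vf_support X. fst p = M \<and> \<delta> - (\<alpha> * fst p + \<beta> * snd p) = K"
  proof (rule ccontr)
    assume "\<not> ?thesis"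
    then have "\<not> (fst p = M \<and> \<delta> - (\<alpha> * fst p + \<beta> * snd p) = K)" if "p \<in> vf_support X" for p
      using that by blast
    then have "a_coeff (y_compactification \<alpha> \<beta> \<delta> X) M K = 0" "b_coeff (y_compactification \<alpha> \<beta> \<delta> X) M K = 0"
      unfolding a_coeff_y_compactification_sum b_coeff_y_compactification_sum
      by (intro sum.neutral ballI if_not_P; blast)+
    then show False using q MK by (simp add: mem_vf_support)
  qed
  then show "q \<in> (\<lambda>(m, n). (m, \<delta> - (\<alpha> * m + \<beta> * n))) ` vf_support X"
    unfolding MK by force
next
  fix q assume "q \<in> (\<lambda>(m, n). (m, \<delta> - (\<alpha> * m + \<beta> * n))) ` vf_support X"
  then obtain m n where q: "q = (m, \<delta> - (\<alpha> * m + \<beta> * n))" and mn: "(m, n) \<in> vf_support X" by auto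
  show "q \<in> vf_support (y_compactification \<alpha> \<beta> \<delta> X)"
    unfolding q mem_vf_support a_coeff_y_compactification b_coeff_y_compactification
    using mn \<beta> by (auto simp: mem_vf_support)
qed

text \<open>At \<open>(1, -1)\<close> this gives the zero below the diagonal of the Jacobian at the
  origin.\<close>

lemma vf_support_y_compactification_nonneg:
  "(m, k) \<in> vf_support (y_compactification \<alpha> \<beta> \<delta> X) \<Longrightarrow> 0 \<le> k"
  unfolding vf_support_y_compactification using weight_le by fastforce

lemma emb_vf_support_y_compactification:
  "emb ` vf_support (y_compactification \<alpha> \<beta> \<delta> X) = exponent_map \<alpha> \<beta> \<delta> ` emb ` vf_support X"
  unfolding vf_support_y_compactification image_image
  by (intro image_cong) (auto simp: emb_def exponent_map_def)

end

section \<open>The exponent map as an affine map\<close>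

lemma exponent_map_convex_hull:
  "exponent_map \<alpha> \<beta> \<delta> ` (convex hull S) = convex hull (exponent_map \<alpha> \<beta> \<delta> ` S)"
proof -
  define L :: "real \<times> real \<Rightarrow> real \<times> real"
    where "L p = (fst p, - real_of_int \<alpha> * fst p - real_of_int \<beta> * snd p)" for p
  have "linear L" by (auto intro!: linearI simp: L_def algebra_simps)
  moreover have eq: "exponent_map \<alpha> \<beta> \<delta> ` T = (+) (0, real_of_int \<delta>) ` L ` T" for T
    unfolding image_image by (intro image_cong) (auto simp: exponent_map_def L_def)
  ultimately show ?thesis
    unfolding eq by (simp add: convex_hull_linear_image convex_hull_translation)
qed

lemma interior_exponent_map_image:
  assumes "\<beta> \<noteq> 0" "interior P \<noteq> {}" "convex (exponent_map \<alpha> \<beta> \<delta> ` P)"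
  shows "interior (exponent_map \<alpha> \<beta> \<delta> ` P) \<noteq> {}"
proof
  assume "interior (exponent_map \<alpha> \<beta> \<delta> ` P) = {}"
  then obtain a b where a: "a \<noteq> 0" "exponent_map \<alpha> \<beta> \<delta> ` P \<subseteq> {x. a \<bullet> x = b}"
    using empty_interior_subset_hyperplane[OF assms(3)] by metis
  \<comment> \<open>The gradient of the form \<open>a\<close> composed with the exponent map: a line
    containing the image pulls back to a line containing \<open>P\<close>.\<close>
  let ?c = "(fst a - snd a * real_of_int \<alpha>, - snd a * real_of_int \<beta>)"
  have "?c \<noteq> 0" using a(1) assms(1) by (auto simp: prod_eq_iff)
  moreover have "?c \<bullet> z = b - snd a * real_of_int \<delta>" if "z \<in> P" for z
  proof -
    have "a \<bullet> exponent_map \<alpha> \<beta> \<delta> z = b" using a(2) that by blast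
    then show ?thesis by (simp add: inner_prod_def exponent_map_def algebra_simps)
  qed
  ultimately show False
    using not_constant_on_nonempty_interior[of ?c P] assms(2) by blast
qed

lemma inj_exponent_map: "\<beta> \<noteq> 0 \<Longrightarrow> inj (exponent_map \<alpha> \<beta> \<delta>)"
  by (auto simp: inj_def exponent_map_def prod_eq_iff)

section \<open>Elementary points\<close>

text \<open>Induction on the outer polynomial: in the derivative of \<open>y * p\<close> at the
  origin only the constant term of \<open>p\<close> survives.\<close>

lemma has_derivative_bivariate_poly_at_0:
  fixes p :: "real poly poly"
  shows "((\<lambda>z::real^2. poly (poly p [:z $ 2:]) (z $ 1)) has_derivative
    (\<lambda>h. coeff (coeff p 0) 1 * h $ 1 + coeff (coeff p 1) 0 * h $ 2)) (at 0)"
proof (induction p)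
  case 0
  then show ?case by simp
next
  case (pCons a p)
  have a: "((\<lambda>z::real^2. poly a (z $ 1)) has_derivative (\<lambda>h. coeff a 1 * h $ 1)) (at 0)"
  proof -
    have "(poly a has_derivative (*) (coeff a 1)) (at ((0::real^2) $ 1))"
      using poly_DERIV[of a 0] by (simp add: has_field_derivative_def poly_0_coeff_0 coeff_pderiv)
    moreover have "((\<lambda>z::real^2. z $ 1) has_derivative (\<lambda>h. h $ 1)) (at 0)"
      by (intro bounded_linear_imp_has_derivative bounded_linear_vec_nth)
    ultimately show ?thesis
      by (rule has_derivative_compose[rotated])
  qed
  have "((\<lambda>z::real^2. z $ 2) has_derivative (\<lambda>h. h $ 2)) (at 0)"
    by (intro bounded_linear_imp_has_derivative bounded_linear_vec_nth)
  from has_derivative_add[OF a has_derivative_mult[OF this pCons.IH]]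
  show ?case by (simp add: poly_0_coeff_0 mult.commute)
qed

lemma vf_eq_axis:
  "vf Y z = poly (poly (fst Y) [:z $ 2:]) (z $ 1) *\<^sub>R axis 1 1 + poly (poly (snd Y) [:z $ 2:]) (z $ 1) *\<^sub>R axis 2 1"
  by (simp add: vf_def vec_eq_iff forall_2 axis_def)

lemma vf_at_0:
  "vf Y 0 = vector [a_coeff Y (-1) 0, b_coeff Y 0 (-1)]"
  by (simp add: vf_def poly_0_coeff_0 a_coeff_def b_coeff_def)

lemma jacobian_vf_at_0:
  "jacobian (vf Y) (at 0) $ 1 $ 1 = a_coeff Y 0 0"
  "jacobian (vf Y) (at 0) $ 2 $ 1 = b_coeff Y 1 (-1)"
  "jacobian (vf Y) (at 0) $ 2 $ 2 = b_coeff Y 0 0"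
proof -
  let ?D = "\<lambda>h::real^2. (coeff (coeff (fst Y) 0) 1 * h $ 1 + coeff (coeff (fst Y) 1) 0 * h $ 2) *\<^sub>R axis 1 1 +
     (coeff (coeff (snd Y) 0) 1 * h $ 1 + coeff (coeff (snd Y) 1) 0 * h $ 2) *\<^sub>R (axis 2 1 :: real^2)"
  have "(vf Y has_derivative ?D) (at 0)"
    unfolding vf_eq_axis[abs_def]
    by (intro has_derivative_add has_derivative_scaleR_left has_derivative_bivariate_poly_at_0)
  then have "frechet_derivative (vf Y) (at 0) = ?D"
    by (rule frechet_derivative_at[symmetric])
  then have J: "jacobian (vf Y) (at 0) = matrix ?D"
    by (simp add: jacobian_def)
  show "jacobian (vf Y) (at 0) $ 1 $ 1 = a_coeff Y 0 0"
    "jacobian (vf Y) (at 0) $ 2 $ 1 = b_coeff Y 1 (-1)"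
    "jacobian (vf Y) (at 0) $ 2 $ 2 = b_coeff Y 0 0"
    unfolding J by (simp_all add: matrix_def axis_def a_coeff_def b_coeff_def)
qed

lemma complex_eigenvalue_upper_triangular:
  fixes A :: "real^2^2"
  assumes "A $ 2 $ 1 = 0"
  shows "complex_eigenvalue A l \<longleftrightarrow> l = complex_of_real (A $ 1 $ 1) \<or> l = complex_of_real (A $ 2 $ 2)"
proof -
  let ?c = complex_of_real
  have ev: "map_matrix ?c A *v w = l *s w \<longleftrightarrow>
      ?c (A $ 1 $ 1) * w $ 1 + ?c (A $ 1 $ 2) * w $ 2 = l * w $ 1 \<and> ?c (A $ 2 $ 2) * w $ 2 = l * w $ 2" for w
    using assms by (simp add: vec_eq_iff forall_2 matrix_vector_mult_def sum_2 map_matrix_def)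
  show ?thesis
  proof
    assume "complex_eigenvalue A l"
    then obtain w where w: "w \<noteq> 0" "map_matrix ?c A *v w = l *s w"
      by (auto simp: complex_eigenvalue_def)
    then show "l = ?c (A $ 1 $ 1) \<or> l = ?c (A $ 2 $ 2)"
      unfolding ev by (cases "w $ 2 = 0") (auto simp: vec_eq_iff forall_2)
  next
    assume l: "l = ?c (A $ 1 $ 1) \<or> l = ?c (A $ 2 $ 2)"
    show "complex_eigenvalue A l"
    proof (cases "l = ?c (A $ 1 $ 1)")
      case True
      show ?thesis unfolding complex_eigenvalue_def ev
        by (intro exI[of _ "vector [1, 0]"]) (simp add: True vec_eq_iff forall_2)
    next
      case False
      then have "l = ?c (A $ 2 $ 2)" "?c (A $ 2 $ 2) - ?c (A $ 1 $ 1) \<noteq> 0" using l by auto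
      \<comment> \<open>This vector solves the first row for the eigenvalue
        \<open>A $ 2 $ 2\<close>; it is nonzero because the diagonal entries differ.\<close>
      then show ?thesis unfolding complex_eigenvalue_def ev
        by (intro exI[of _ "vector [?c (A $ 1 $ 2), ?c (A $ 2 $ 2) - ?c (A $ 1 $ 1)]"])
          (auto simp: vec_eq_iff forall_2 algebra_simps)
    qed
  qed
qed

text \<open>The eigenvalues are the real diagonal entries: a singularity with two nonzero ones is
  hyperbolic, with just one semi-hyperbolic.\<close>

lemma elementary_point_upper_triangular:
  fixes f :: "real^2 \<Rightarrow> real^2"
  assumes "jacobian f (at q) $ 2 $ 1 = 0"
    and "jacobian f (at q) $ 1 $ 1 \<noteq> 0 \<or> jacobian f (at q) $ 2 $ 2 \<noteq> 0"
  shows "elementary_point f q"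
proof (cases "f q = 0")
  case True
  note ev = complex_eigenvalue_upper_triangular[OF assms(1)]
  show ?thesis
  proof (cases "jacobian f (at q) $ 1 $ 1 \<noteq> 0 \<and> jacobian f (at q) $ 2 $ 2 \<noteq> 0")
    case nz: True
    then show ?thesis
      using True by (auto simp: elementary_point_def hyperbolic_singularity_def ev)
  next
    case False
    then show ?thesis
      using True assms(2)
      by (auto simp: elementary_point_def semi_hyperbolic_singularity_def ev)
  qed
qed (simp add: elementary_point_def)

section \<open>The main vertex and the main segment\<close>

lemma lex_le_refl: "lex_le p p"
  by (simp add: lex_le_def)

lemma lex_le_trans: "lex_le p q \<Longrightarrow> lex_le q r \<Longrightarrow> lex_le p r"
  unfolding lex_le_def by linarith

lemma lex_le_linear: "lex_le p q \<or> lex_le q p"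
  unfolding lex_le_def by linarith

lemma lex_le_minimum_exists:
  assumes "finite S" "S \<noteq> {}"
  shows "\<exists>p\<in>S. \<forall>q\<in>S. lex_le p q"
  using assms
proof (induction S rule: finite_ne_induct)
  case (singleton x)
  then show ?case by (simp add: lex_le_def)
next
  case (insert x F)
  then obtain p where "p \<in> F" "\<forall>q\<in>F. lex_le p q" by blast
  then show ?case
    by (metis insert_iff lex_le_linear lex_le_refl lex_le_trans)
qed

lemma lex_le_maximum_exists:
  assumes "finite S" "S \<noteq> {}"
  shows "\<exists>p\<in>S. \<forall>q\<in>S. lex_le q p"
  using assms
proof (induction S rule: finite_ne_induct)
  case (singleton x)
  then show ?case by (simp add: lex_le_def)
next
  case (insert x F)
  then obtain p where "p \<in> F" "\<forall>q\<in>F. lex_le q p" by blast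
  then show ?case
    by (metis insert_iff lex_le_linear lex_le_refl lex_le_trans)
qed

lemma lex_le_antisym: "lex_le p q \<Longrightarrow> lex_le q p \<Longrightarrow> p = q"
  by (auto simp: lex_le_def prod_eq_iff)

lemma first_support_point:
  assumes "vf_support X \<noteq> {}"
  shows "first_support_point X \<in> vf_support X"
    and "q \<in> vf_support X \<Longrightarrow> lex_le (first_support_point X) q"
proof -
  have "\<exists>!p. p \<in> vf_support X \<and> (\<forall>q\<in>vf_support X. lex_le p q)"
    using lex_le_minimum_exists[OF finite_vf_support assms] lex_le_antisym by blast
  from theI'[OF this] show "first_support_point X \<in> vf_support X"
    and "q \<in> vf_support X \<Longrightarrow> lex_le (first_support_point X) q"
    unfolding first_support_point_def by blast+
qed

lemma upper_main_vertex:
  assumes "vf_support X \<noteq> {}"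
  shows "upper_main_vertex X \<in> vf_support X"
    and "q \<in> newton_polytope X \<Longrightarrow> snd q \<le> real_of_int (snd (upper_main_vertex X))"
    and "p \<in> vf_support X \<Longrightarrow> snd p = snd (upper_main_vertex X) \<Longrightarrow> fst p \<le> fst (upper_main_vertex X)"
proof -
  define C where "C = {p \<in> vf_support X. \<forall>q\<in>newton_polytope X. snd q \<le> real_of_int (snd p)}"
  have "finite C" unfolding C_def using finite_vf_support by simp
  moreover have "C \<noteq> {}"
  proof -
    have fin: "finite (snd ` vf_support X)" and ne: "snd ` vf_support X \<noteq> {}"
      using assms finite_vf_support by auto
    obtain p where p: "p \<in> vf_support X" "snd p = Max (snd ` vf_support X)"
      using Max_in[OF fin ne] by (metis imageE)
    have "snd q \<le> real_of_int (snd p)" if "q \<in> newton_polytope X" for q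
    proof -
      have "(0, 1) \<bullet> q \<le> real_of_int (snd p)"
      proof (rule affine_le_on_convex_hull)
        show "q \<in> convex hull (emb ` vf_support X)" using that by (simp add: newton_polytope_def)
        show "(0, 1) \<bullet> s \<le> real_of_int (snd p)" if "s \<in> emb ` vf_support X" for s
          using that fin p by (auto simp: inner_prod_def emb_def intro!: Max_ge rev_image_eqI)
      qed
      then show ?thesis by (simp add: inner_prod_def)
    qed
    then show ?thesis using p(1) unfolding C_def by blast
  qed
  ultimately have "\<exists>!p. p \<in> C \<and> (\<forall>q\<in>C. lex_le q p)"
    using lex_le_maximum_exists[of C] lex_le_antisym by blast
  from theI'[OF this] have u: "upper_main_vertex X \<in> C" "\<And>q. q \<in> C \<Longrightarrow> lex_le q (upper_main_vertex X)"
    unfolding upper_main_vertex_def C_def[symmetric] Let_def by blast+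
  then show "upper_main_vertex X \<in> vf_support X"
    and "q \<in> newton_polytope X \<Longrightarrow> snd q \<le> real_of_int (snd (upper_main_vertex X))"
    unfolding C_def by blast+
  show "fst p \<le> fst (upper_main_vertex X)"
    if "p \<in> vf_support X" "snd p = snd (upper_main_vertex X)"
  proof -
    have "p \<in> C" using that u(1) unfolding C_def by simp
    then show ?thesis using u(2)[of p] that(2) by (auto simp: lex_le_def)
  qed
qed

text \<open>The point is the right end of the top face. Extremality puts it in the vertex list,
  which makes \<open>upper_main_index\<close> well defined.\<close>

lemma upper_main_vertex_extreme:
  assumes "vf_support X \<noteq> {}"
  shows "emb (upper_main_vertex X) extreme_point_of newton_polytope X"
proof -
  let ?P = "newton_polytope X" and ?w = "emb (upper_main_vertex X)"
  define T where "T = ?P \<inter> {z. (0, - 1) \<bullet> z = - snd ?w}"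
  have cP: "compact ?P" "convex ?P"
    unfolding newton_polytope_def
    using finite_vf_support finite_imp_compact_convex_hull convex_convex_hull by (blast intro: finite_imageI)+
  have top: "snd q \<le> snd ?w" if "q \<in> ?P" for q
    using upper_main_vertex(2)[OF assms that] by (simp add: emb_def)
  have face: "T face_of ?P"
    unfolding T_def using cP top
    by (intro face_of_Int_supporting_hyperplane_ge) (auto simp: inner_prod_def)
  \<comment> \<open>The definition compares support points only. Extreme points of the top face are
    extreme in the polytope, hence support points, and they span the face.\<close>
  have "fst z \<le> fst ?w" if z: "z \<in> T" for z
  proof -
    have "compact T" "convex T"
      using face cP face_of_imp_compact face_of_imp_convex by blast+
    then have hull: "T = convex hull {x. x extreme_point_of T}"
      by (rule Krein_Milman_Minkowski)
    have "(1, 0) \<bullet> z \<le> fst ?w"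
    proof (rule affine_le_on_convex_hull)
      show "z \<in> convex hull {x. x extreme_point_of T}" using z hull by blast
      fix s assume "s \<in> {x. x extreme_point_of T}"
      then have "s extreme_point_of T" by simp
      then have "s extreme_point_of ?P" and sT: "s \<in> T"
        using extreme_point_of_face[OF face] by (auto simp: extreme_point_of_def)
      then have "s \<in> emb ` vf_support X"
        unfolding newton_polytope_def by (rule_tac extreme_point_of_convex_hull)
      then obtain p where p: "s = emb p" "p \<in> vf_support X" by blast
      then have "snd p = snd (upper_main_vertex X)"
        using sT by (simp add: T_def inner_prod_def emb_def)
      then show "(1, 0) \<bullet> s \<le> fst ?w"
        using upper_main_vertex(3)[OF assms p(2)] p(1) by (simp add: inner_prod_def emb_def)
    qed
    then show ?thesis by (simp add: inner_prod_def)
  qed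
  then have right: "fst z \<le> fst ?w" if "z \<in> ?P" "snd z = snd ?w" for z
    using that by (simp add: T_def inner_prod_def)
  have wP: "?w \<in> ?P"
    unfolding newton_polytope_def using upper_main_vertex(1)[OF assms] by (intro hull_inc) simp
  have "?w \<notin> open_segment a b" if ab: "a \<in> ?P" "b \<in> ?P" for a b
  proof
    assume "?w \<in> open_segment a b"
    then obtain u where u: "a \<noteq> b" "0 < u" "u < 1" "?w = (1 - u) *\<^sub>R a + u *\<^sub>R b"
      by (auto simp: in_segment)
    \<comment> \<open>A proper convex combination of numbers at most \<open>c\<close> equals
      \<open>c\<close> only if both do; applied to ordinates, then to abscissae.\<close>
    have conv: "x = c \<and> y = c" if "x \<le> c" "y \<le> c" "c = (1 - u) * x + u * y" for x y c :: real
    proof -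
      have "(1 - u) * (c - x) + u * (c - y) = 0" using that(3) by (simp add: algebra_simps)
      moreover have "0 \<le> (1 - u) * (c - x)" "0 \<le> u * (c - y)" using that u by auto
      ultimately have "(1 - u) * (c - x) = 0" "u * (c - y) = 0" by linarith+
      then show ?thesis using u by auto
    qed
    have fst_w: "fst ?w = (1 - u) * fst a + u * fst b" and snd_w: "snd ?w = (1 - u) * snd a + u * snd b"
      unfolding u(4) by simp_all
    have s: "snd a = snd ?w \<and> snd b = snd ?w"
      by (rule conv[OF top[OF ab(1)] top[OF ab(2)] snd_w])
    have "fst a = fst ?w \<and> fst b = fst ?w"
      using s by (intro conv[OF right[OF ab(1)] right[OF ab(2)] fst_w]) auto
    then show False using s u(1) by (simp add: prod_eq_iff)
  qed
  then show ?thesis using wP by (simp add: extreme_point_of_def)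
qed

lemma upper_main_index:
  assumes "vf_support X \<noteq> {}" "ccw_vertices X ps"
  shows "1 \<le> upper_main_index X ps" "upper_main_index X ps \<le> length ps"
    and "ps ! (upper_main_index X ps mod length ps) = emb (upper_main_vertex X)"
proof -
  let ?N = "length ps"
  have "emb (upper_main_vertex X) \<in> set ps" and d: "distinct ps"
    using assms upper_main_vertex_extreme by (auto simp: ccw_vertices_def)
  then obtain j where j: "j < ?N" "ps ! j = emb (upper_main_vertex X)"
    by (auto simp: in_set_conv_nth)
  have "\<exists>!l. l \<in> {1..?N} \<and> ps ! (l mod ?N) = emb (upper_main_vertex X)"
  proof (rule ex1I)
    \<comment> \<open>The index runs over \<open>1..N\<close>, so a main vertex in position
      \<open>0\<close> is the end of segment \<open>N\<close>.\<close>
    show "(if j = 0 then ?N else j) \<in> {1..?N} \<and> ps ! ((if j = 0 then ?N else j) mod ?N) = emb (upper_main_vertex X)"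
      using j by auto
    fix l assume l: "l \<in> {1..?N} \<and> ps ! (l mod ?N) = emb (upper_main_vertex X)"
    then have "l mod ?N = j"
      using j d by (metis length_pos_if_in_set mod_less_divisor nth_eq_iff_index_eq nth_mem)
    then show "l = (if j = 0 then ?N else j)"
      using l by (cases "l = ?N") auto
  qed
  from theI'[OF this] show "1 \<le> upper_main_index X ps" "upper_main_index X ps \<le> length ps"
    and "ps ! (upper_main_index X ps mod length ps) = emb (upper_main_vertex X)"
    unfolding upper_main_index_def by auto
qed

text \<open>A favorable field has an edge, hence two distinct points in its polytope, so the list
  has at least two vertices.\<close>

lemma upper_main_polygonI:
  assumes fav: "favorable X" and ccw: "ccw_vertices X ps" and pos: "0 < \<alpha>" "0 < \<beta>"
    and line: "upper_main_segment X ps \<subseteq> {(m, n). real_of_int \<alpha> * m + real_of_int \<beta> * n = real_of_int \<delta>}"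
  shows "upper_main_polygon (emb ` vf_support X) ps (upper_main_index X ps) \<alpha> \<beta> \<delta>"
proof -
  let ?S = "emb ` vf_support X" and ?h = "upper_main_index X ps" and ?N = "length ps"
  obtain F where "F edge_of newton_polytope X" using fav by (auto simp: favorable_def)
  then obtain x y where xy: "x \<in> newton_polytope X" "y \<in> newton_polytope X" "x \<noteq> y"
    using edge_of_two_points edge_of_imp_subset by (metis subsetD)
  then have ne: "vf_support X \<noteq> {}" by (auto simp: newton_polytope_def)
  have fin: "finite ?S" using finite_vf_support by simp
  have d: "distinct ps" and vs: "set ps = {v. v extreme_point_of convex hull ?S}"
    and first: "ps ! 0 = emb (first_support_point X)"
    and left: "\<And>i q. i < ?N \<Longrightarrow> q \<in> convex hull ?S \<Longrightarrow> 0 \<le> orient (ps ! i) (ps ! (Suc i mod ?N)) q"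
    using ccw by (auto simp: ccw_vertices_def newton_polytope_def)
  have hull: "newton_polytope X = convex hull set ps"
    unfolding vs newton_polytope_def
    by (intro Krein_Milman_Minkowski finite_imp_compact_convex_hull fin convex_convex_hull)
  have "2 \<le> ?N"
  proof (rule ccontr)
    assume "\<not> 2 \<le> ?N"
    then consider "ps = []" | v where "ps = [v]" by (cases ps; cases "tl ps") auto
    then show False using xy hull by cases auto
  qed
  then interpret ccw_polygon ?S ps
  proof (unfold_locales, goal_cases)
    case (5 s)
    then obtain p where "s = emb p" "p \<in> vf_support X" by blast
    then show ?case
      using first_support_point(2)[OF ne, of p] by (auto simp: first lex_le_def emb_def)
  qed (use fin d vs left in auto)
  have h: "1 \<le> ?h" "?h \<le> ?N" and vh: "vert ?h = emb (upper_main_vertex X)"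
    using upper_main_index[OF ne ccw] by (auto simp: vert_def)
  have "vert (?h - 1) = ps ! (?h - 1)" using h by (simp add: vert_def)
  then have "upper_main_segment X ps = closed_segment (vert (?h - 1)) (vert ?h)"
    by (simp add: upper_main_segment_def seg_def vert_def)
  then have "vert (?h - 1) \<in> upper_main_segment X ps" "vert ?h \<in> upper_main_segment X ps" by auto
  then have "\<alpha> * fst (vert (?h - 1)) + \<beta> * snd (vert (?h - 1)) = \<delta>" "\<alpha> * fst (vert ?h) + \<beta> * snd (vert ?h) = \<delta>"
    using line by (auto simp: case_prod_unfold)
  moreover have "snd z \<le> snd (vert ?h)" if "z \<in> P" for z
    using upper_main_vertex(2)[OF ne, of z] that unfolding vh by (simp add: newton_polytope_def emb_def)
  ultimately show ?thesis
    using h pos by unfold_locales auto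
qed

text \<open>If the polytope is a segment, the first vertex is the main vertex and no segment follows
  it. The left upper part is then empty, while the lower boundary is by convention the whole image;
  hence the restriction in the first claim.\<close>

theorem proposition13:
  fixes X :: poly_vf and ps :: "(real \<times> real) list" and \<alpha> \<beta> \<delta> :: int
  assumes "favorable X"
    and "ccw_vertices X ps"
    and "\<alpha> > 0" and "\<beta> > 0"
    and "upper_main_segment X ps \<subseteq> {(m, n). real_of_int \<alpha> * m + real_of_int \<beta> * n = real_of_int \<delta>}"
  shows "(interior (newton_polytope X) \<noteq> {} \<longrightarrow>
            lower_boundary (y_compactification \<alpha> \<beta> \<delta> X)
              = exponent_map \<alpha> \<beta> \<delta> ` left_upper_part X ps) \<and>
         (upper_main_vertex X \<in> {-1} \<times> range int \<or> upper_main_vertex X \<in> {0} \<times> range int \<longrightarrow>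
            elementary_point (vf (y_compactification \<alpha> \<beta> \<delta> X)) 0)"
proof -
  let ?S = "emb ` vf_support X" and ?h = "upper_main_index X ps" and ?\<phi> = "exponent_map \<alpha> \<beta> \<delta>"
  let ?Y = "y_compactification \<alpha> \<beta> \<delta> X"
  interpret upper_main_polygon ?S ps ?h \<alpha> \<beta> \<delta>
    by (rule upper_main_polygonI[OF assms])
  have ne: "vf_support X \<noteq> {}" using vert_in_S[of 0] by blast
  have P: "newton_polytope X = P" by (simp add: newton_polytope_def)
  have weight: "\<forall>(m, n)\<in>vf_support X. \<alpha> * m + \<beta> * n \<le> \<delta>"
  proof clarify
    fix m n assume "(m, n) \<in> vf_support X"
    then have "emb (m, n) \<in> P" by (intro hull_inc) simp
    then have "real_of_int (\<alpha> * m + \<beta> * n) \<le> real_of_int \<delta>"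
      using weight_le_main by (force simp: emb_def)
    then show "\<alpha> * m + \<beta> * n \<le> \<delta>" by linarith
  qed
  note nonnegY = vf_support_y_compactification_nonneg[of \<beta> X \<alpha> \<delta>, OF assms(4) weight]
    and aY = a_coeff_y_compactification[of \<beta> X \<alpha> \<delta>, OF assms(4) weight]
    and bY = b_coeff_y_compactification[of \<beta> X \<alpha> \<delta>, OF assms(4) weight]
  have a: "lower_boundary ?Y = ?\<phi> ` left_upper_part X ps" if int: "interior (newton_polytope X) \<noteq> {}"
  proof -
    have intP: "interior P \<noteq> {}" using int P by simp
    let ?T = "emb ` vf_support ?Y"
    have hullT: "convex hull ?T = ?\<phi> ` P"
      unfolding emb_vf_support_y_compactification[of \<beta> X \<alpha> \<delta>, OF assms(4) weight]
      by (simp add: exponent_map_convex_hull)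
    have intT: "interior (convex hull ?T) \<noteq> {}"
      unfolding hullT using assms(4) intP
      by (intro interior_exponent_map_image) (auto simp: exponent_map_convex_hull)
    have inj: "inj ?\<phi>" using inj_exponent_map assms(4) by simp
    have lower: "lower_boundary ?Y = \<Union>{argmin_face c (?\<phi> ` P) |c. 0 < fst c \<and> 0 < snd c \<and>
        (\<exists>x y. x \<in> argmin_face c (?\<phi> ` P) \<and> y \<in> argmin_face c (?\<phi> ` P) \<and> x \<noteq> y)}"
    proof -
      have "newton_polytope_plus ?Y = quadrant_hull ?T"
        by (simp add: newton_polytope_plus_def quadrant_hull_def)
      moreover have "finite ?T" using finite_vf_support by simp
      ultimately show ?thesis
        using compact_edges_quadrant_hull[OF _ intT] intT
        by (simp add: lower_boundary_def newton_polytope_def hullT)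
    qed
    have upper: "upper_boundary X = closure (frontier P - frontier (quadrant_hull ?S))"
      using intP by (simp add: upper_boundary_def P newton_polytope_plus_def quadrant_hull_def)
    \<comment> \<open>Segments are numbered from \<open>1\<close> and edges from \<open>0\<close>,
      so the segments after the main one are the edges from index \<open>?h\<close> on.\<close>
    have seg_edge: "seg ps (Suc i) = edge i" if "i < N" for i
      using that by (simp add: seg_def vert_def)
    have left_part: "left_upper_part X ps = \<Union>{edge i |i. ?h \<le> i \<and> i < N \<and> dx i < 0}"
    proof -
      have "{seg ps l |l. ?h < l \<and> l \<le> N \<and> seg ps l \<subseteq> upper_boundary X} =
        {edge i |i. ?h \<le> i \<and> i < N \<and> dx i < 0}"
      proof (intro equalityI subsetI)
        fix E assume "E \<in> {seg ps l |l. ?h < l \<and> l \<le> N \<and> seg ps l \<subseteq> upper_boundary X}"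
        then obtain l where l: "E = seg ps l" "?h < l" "l \<le> N" "seg ps l \<subseteq> upper_boundary X" by blast
        then obtain i where i: "l = Suc i" by (cases l) auto
        then have "?h \<le> i" "i < N" using l by auto
        then show "E \<in> {edge i |i. ?h \<le> i \<and> i < N \<and> dx i < 0}"
          using l i left_chain_upper_iff[OF intP] seg_edge upper by auto
      next
        fix E assume "E \<in> {edge i |i. ?h \<le> i \<and> i < N \<and> dx i < 0}"
        then obtain i where i: "E = edge i" "?h \<le> i" "i < N" "dx i < 0" by blast
        then show "E \<in> {seg ps l |l. ?h < l \<and> l \<le> N \<and> seg ps l \<subseteq> upper_boundary X}"
          using left_chain_upper_iff[OF intP, of i] seg_edge[of i] upper
          by (intro CollectI exI[of _ "Suc i"]) auto
      qed
      then show ?thesis by (simp add: left_upper_part_def)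
    qed
    \<comment> \<open>Minimizing \<open>c\<close> on the image amounts to maximizing on
      \<open>P\<close> the form whose coefficients appear in the inner parentheses.\<close>
    have inner_\<phi>: "c \<bullet> ?\<phi> z = snd c * \<delta> - ((snd c * \<alpha> - fst c) * fst z + snd c * \<beta> * snd z)" for c z
      by (simp add: inner_prod_def exponent_map_def algebra_simps)
    show ?thesis
    proof (intro equalityI subsetI)
      fix w assume "w \<in> lower_boundary ?Y"
      then obtain c x y where c: "0 < fst c" "0 < snd c" and w: "w \<in> argmin_face c (?\<phi> ` P)"
        and xy: "x \<in> argmin_face c (?\<phi> ` P)" "y \<in> argmin_face c (?\<phi> ` P)" "x \<noteq> y"
        unfolding lower by auto
      let ?G = "{z \<in> P. ?\<phi> z \<in> argmin_face c (?\<phi> ` P)}"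
      obtain x' y' z where pre: "w = ?\<phi> z" "x = ?\<phi> x'" "y = ?\<phi> y'" "z \<in> P" "x' \<in> P" "y' \<in> P"
        using w xy unfolding argmin_face_def by blast
      have "\<exists>i. ?h \<le> i \<and> i < N \<and> dx i < 0 \<and> z \<in> edge i"
      proof (rule maximal_face_in_left_chain[OF intP, of "snd c * \<beta>" "snd c * \<alpha> - fst c" ?G x' y'])
        show "0 < snd c * \<beta>" using c assms(4) by simp
        have "0 < fst c * \<beta>" using c assms(4) by simp
        then show "(snd c * \<alpha> - fst c) * \<beta> < snd c * \<beta> * \<alpha>" by (simp add: algebra_simps)
        fix g v assume "g \<in> ?G" "v \<in> P"
        then have "c \<bullet> ?\<phi> g \<le> c \<bullet> ?\<phi> v" by (auto simp: argmin_face_def)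
        then show "(snd c * \<alpha> - fst c) * fst v + snd c * \<beta> * snd v \<le>
          (snd c * \<alpha> - fst c) * fst g + snd c * \<beta> * snd g" unfolding inner_\<phi> by simp
      qed (use pre w xy in auto)
      then show "w \<in> ?\<phi> ` left_upper_part X ps" unfolding left_part pre(1) by blast
    next
      fix w assume "w \<in> ?\<phi> ` left_upper_part X ps"
      then obtain i z where i: "?h \<le> i" "i < N" "dx i < 0" and z: "z \<in> edge i" "w = ?\<phi> z"
        unfolding left_part by blast
      \<comment> \<open>The solution of \<open>snd c * \<alpha> - fst c = \<beta> * dy i\<close> and
        \<open>snd c * \<beta> = - \<beta> * dx i\<close>: the pulled-back form becomes
        \<open>\<beta>\<close> times the outer normal of the edge.\<close>
      let ?c = "(- (\<alpha> * dx i + \<beta> * dy i), - dx i)"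
      have c\<phi>: "?c \<bullet> ?\<phi> v = - dx i * \<delta> - \<beta> * (dy i * fst v - dx i * snd v)" for v
        by (simp add: inner_\<phi> algebra_simps)
      have sub: "?\<phi> v \<in> argmin_face ?c (?\<phi> ` P)" if "v \<in> edge i" for v
      proof -
        have "?c \<bullet> ?\<phi> v \<le> ?c \<bullet> ?\<phi> r" if "r \<in> P" for r
          unfolding c\<phi> using edge_maximizes_outer_normal[OF \<open>v \<in> edge i\<close> that] assms(4) by simp
        then show ?thesis
          unfolding argmin_face_def using edge_subset_P[of i] \<open>v \<in> edge i\<close> by blast
      qed
      have "?\<phi> (vert i) \<noteq> ?\<phi> (vert (Suc i))"
        using inj vert_Suc_neq[of i] by (metis injD)
      then have two: "\<exists>x y. x \<in> argmin_face ?c (?\<phi> ` P) \<and> y \<in> argmin_face ?c (?\<phi> ` P) \<and> x \<noteq> y"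
        using sub[of "vert i"] sub[of "vert (Suc i)"] by blast
      have c: "0 < fst ?c" "0 < snd ?c"
        using i(3) left_chain_weight_decreasing[OF intP i] by simp_all
      have "w \<in> argmin_face ?c (?\<phi> ` P)" using sub[OF z(1)] z(2) by simp
      then show "w \<in> lower_boundary ?Y"
        unfolding lower by (intro UnionI[of "argmin_face ?c (?\<phi> ` P)"] CollectI exI[of _ ?c] conjI refl c two)
    qed
  qed
  have b: "elementary_point (vf ?Y) 0" if m: "fst (upper_main_vertex X) = -1 \<or> fst (upper_main_vertex X) = 0"
  proof -
    obtain m n where mn: "upper_main_vertex X = (m, n)" by fastforce
    have mnS: "(m, n) \<in> vf_support X" using upper_main_vertex(1)[OF ne] mn by simp
    have "vert ?h = emb (m, n)"
      using upper_main_index(3)[OF ne assms(2)] mn by (simp add: vert_def)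
    then have "real_of_int (\<alpha> * m + \<beta> * n) = real_of_int \<delta>"
      using line(2) by (simp add: emb_def)
    \<comment> \<open>The main vertex lies on the line, so its image is \<open>(m, 0)\<close>: a
      constant term of the first component if \<open>m = -1\<close>, a diagonal linear term if
      \<open>m = 0\<close>.\<close>
    then have \<delta>: "\<delta> = \<alpha> * m + \<beta> * n" by linarith
    show ?thesis
    proof (cases "m = -1")
      case True
      then have "b_coeff X m n = 0" by (simp add: b_coeff_def)
      then have "a_coeff X m n \<noteq> 0" using mnS by (simp add: mem_vf_support)
      then have "a_coeff ?Y (-1) 0 \<noteq> 0"
        using aY[of m n] \<open>b_coeff X m n = 0\<close> True \<delta> by simp
      then have "vf ?Y 0 \<noteq> 0" by (simp add: vf_at_0 vec_eq_iff forall_2)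
      then show ?thesis by (simp add: elementary_point_def)
    next
      case False
      then have m0: "m = 0" using m mn by simp
      have "a_coeff ?Y 0 0 \<noteq> 0 \<or> b_coeff ?Y 0 0 \<noteq> 0"
        using aY[of m n] bY[of m n] mnS m0 \<delta> assms(4) by (auto simp: mem_vf_support)
      moreover have "b_coeff ?Y 1 (-1) = 0"
        using nonnegY[of 1 "-1"] by (auto simp: mem_vf_support)
      ultimately show ?thesis
        by (intro elementary_point_upper_triangular) (auto simp: jacobian_vf_at_0)
    qed
  qed
  show ?thesis
    using a b by (auto simp: mem_Times_iff)
qed

end
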